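(* There is a randomized prediction-based online algorithm for (unweighted) caching with cache size $k$ whose competitive ratio against any offline algorithm $\textsc{Off}$ is \[O\left(\min\left\{1+\log\left(1+\frac{\eta}{\textsc{Off}}\right),\;\log k\right\}\right),\] where $\eta$ is the prediction error with respect to $\textsc{Off}$ and $\textsc{Off}$ also denotes the cost of the offline algorithm.
   Context: In caching, a cache can hold $k$ pages. A sequence of page requests $r_1,r_2,\dots,r_T$ arrives online; if the requested page is in the cache nothing happens, otherwise a page fault occurs, the page must be loaded into the cache (evicting another page if the cache is full) at cost $1$. Caching is viewed as a metrical task system whose states are cache configurations (sets of $k$ pages), with distance between configurations $X,Y$ equal to $|X\setminus Y|$, and request $r_t$ imposing infinite cost on configurations not containing $r_t$ and zero cost otherwise. A prediction-based algorithm receives at each time $t$ a predicted configuration $P_t$. For an offline algorithm $\textsc{Off}$ with configurations $O_1,\dots,O_T$, the prediction error is $\eta=\sum_{t}|P_t\setminus O_t|$. An algorithm has competitive ratio $r$ against $\textsc{Off}$ if there is a constant $c$ independent of the input with expected cost at most $r\cdot\textsc{Off}+c$ on every input. *)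

theory Defs
  imports "HOL-Probability.Probability_Mass_Function"
begin

definition configs :: "'a set \<Rightarrow> nat \<Rightarrow> 'a set set" where
  "configs U k = {X. X \<subseteq> U \<and> finite X \<and> card X = k}"

definition config_dist :: "'a set \<Rightarrow> 'a set \<Rightarrow> real" where
  "config_dist X Y = real (card (X - Y))"

definition movement_cost :: "'a set list \<Rightarrow> real" where
  "movement_cost Xs = (\<Sum>t<length Xs - 1. config_dist (Xs ! t) (Xs ! Suc t))"

text \<open>A schedule has infinite cost exactly if some configuration misses the current request.
  Such schedules are excluded here, so the cost of a schedule is its movement cost.\<close>

definition serves :: "'a set \<Rightarrow> nat \<Rightarrow> 'a list \<Rightarrow> 'a set list \<Rightarrow> bool" where
  "serves U k rs Xs \<longleftrightarrow> list_all2 (\<lambda>r X. X \<in> configs U k \<and> r \<in> X) rs Xs"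

definition prediction_error :: "'a set list \<Rightarrow> 'a set list \<Rightarrow> real" where
  "prediction_error Ps Os = (\<Sum>t<length Ps. config_dist (Ps ! t) (Os ! t))"

text \<open>At time \<open>t\<close>, a randomized online algorithm sees its own past configurations
  \<open>[X\<^sub>0, \<dots>, X\<^sub>t\<^sub>-\<^sub>1]\<close> and the requests with predictions \<open>[(r\<^sub>1, P\<^sub>1), \<dots>, (r\<^sub>t, P\<^sub>t)]\<close> revealed so far,
  and draws its next configuration \<open>X\<^sub>t\<close>.\<close>

type_synonym 'a online_alg = "'a set list \<Rightarrow> ('a \<times> 'a set) list \<Rightarrow> 'a set pmf"

text \<open>The joint law of \<open>[X\<^sub>0, \<dots>, X\<^sub>t]\<close>. The input is fixed in advance (oblivious adversary).\<close>

primrec run :: "'a online_alg \<Rightarrow> 'a set \<Rightarrow> ('a \<times> 'a set) list \<Rightarrow> nat \<Rightarrow> 'a set list pmf" where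
  "run A X0 \<sigma> 0 = return_pmf [X0]"
| "run A X0 \<sigma> (Suc t) =
     bind_pmf (run A X0 \<sigma> t) (\<lambda>Xs. map_pmf (\<lambda>X. Xs @ [X]) (A Xs (take (Suc t) \<sigma>)))"

definition caching_alg :: "'a set \<Rightarrow> nat \<Rightarrow> 'a online_alg \<Rightarrow> bool" where
  "caching_alg U k A \<longleftrightarrow>
     (\<forall>X0 \<in> configs U k. \<forall>\<sigma> \<in> lists (U \<times> configs U k).
        \<forall>Xs \<in> set_pmf (run A X0 \<sigma> (length \<sigma>)). serves U k (map fst \<sigma>) (tl Xs))"

text \<open>For \<^const>\<open>caching_alg\<close>s the integrand is bounded by \<open>k * length \<sigma>\<close> on the support, so it
  is integrable.\<close>

definition expected_cost :: "'a online_alg \<Rightarrow> 'a set \<Rightarrow> ('a \<times> 'a set) list \<Rightarrow> real" where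
  "expected_cost A X0 \<sigma> = measure_pmf.expectation (run A X0 \<sigma> (length \<sigma>)) movement_cost"

text \<open>The ratio \<open>\<rho>\<close> is a function of the prediction error and the offline cost. An offline algorithm
  is represented by its schedule \<open>Os\<close> on the given input; it starts in the same
  configuration \<open>X0\<close> as the online algorithm.\<close>

definition competitive_against_offline ::
    "'a set \<Rightarrow> nat \<Rightarrow> 'a online_alg \<Rightarrow> (real \<Rightarrow> real \<Rightarrow> real) \<Rightarrow> bool" where
  "competitive_against_offline U k A \<rho> \<longleftrightarrow>
     (\<exists>c. \<forall>X0 \<in> configs U k. \<forall>\<sigma> \<in> lists (U \<times> configs U k). \<forall>Os.
        serves U k (map fst \<sigma>) Os \<longrightarrow>
        (let \<eta> = prediction_error (map snd \<sigma>) Os; Off = movement_cost (X0 # Os)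
         in expected_cost A X0 \<sigma> \<le> \<rho> \<eta> Off * Off + c))"

end

(* Proof idea.  The requests are cut into blocks with h distinct pages.  Inside a block the algorithm
   keeps a base configuration Q fixed and does randomized marking on it: the cache consists of the
   pages R requested in the block and a uniformly random subset of Q - R.  By symmetry a page of
   Q - R is missing with probability card (R - Q) / card (Q - R).

   With h = (k + 1) div 2 this costs O(card (R - Q)) per block, since Q - R never gets small.  As
   the next base take the medoid of the predictions seen in the block.  By the triangle
   inequality it lies within 2 Off + 3 eta / h of the offline configuration (Off and eta restricted to
   the block), and card (R - Q) is at most the distance of Q to the offline configuration plus the
   offline cost in the block.  Summing up gives O(Off + eta / k).

   With h = k and R itself as next base the same analysis gives marking, with cost O(log k) Off.

   Both expected costs are determined by the input, so an online algorithm can compute them and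
   follow the cheaper algorithm up to a constant factor, switching when the current one exceeds a
   budget that doubles at each switch.  Finally min (1 + x) (ln k) with x = eta / (k Off) is
   O(min (1 + ln (1 + eta / Off)) (ln k)), because x <= O(ln (1 + k x)) for x <= 1. *)

theory Submission
  imports Defs "HOL-Analysis.Harmonic_Numbers" "HOL-Combinatorics.Transposition"
begin

section \<open>Markov algorithms\<close>

text \<open>A kernel gets the initial configuration, the input up to and including the current
  request, and the present configuration, but no older ones. The law of the configuration is then a
  function of the initial configuration and the input, so an online algorithm can compute it
  together with its expected cost.\<close>

type_synonym 'a kernel = "'a set \<Rightarrow> ('a \<times> 'a set) list \<Rightarrow> 'a set \<Rightarrow> 'a set pmf"

fun law :: "'a kernel \<Rightarrow> 'a set \<Rightarrow> ('a \<times> 'a set) list \<Rightarrow> nat \<Rightarrow> 'a set pmf" where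
  "law K X0 \<sigma> 0 = return_pmf X0"
| "law K X0 \<sigma> (Suc t) = bind_pmf (law K X0 \<sigma> t) (K X0 (take (Suc t) \<sigma>))"

lemma law_append: "t \<le> length \<sigma> \<Longrightarrow> law K X0 (\<sigma> @ \<tau>) t = law K X0 \<sigma> t"
  by (induction t) (auto intro!: bind_pmf_cong)

text \<open>Taking the law after the whole input removes the time index, so that inductions can run
  over the input with \<open>rev_induct\<close>.\<close>

definition final :: "'a kernel \<Rightarrow> 'a set \<Rightarrow> ('a \<times> 'a set) list \<Rightarrow> 'a set pmf" where
  "final K X0 \<sigma> = law K X0 \<sigma> (length \<sigma>)"

lemma final_Nil [simp]: "final K X0 [] = return_pmf X0"
  by (simp add: final_def)

lemma final_snoc [simp]: "final K X0 (\<sigma> @ [x]) = bind_pmf (final K X0 \<sigma>) (K X0 (\<sigma> @ [x]))"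
  by (simp add: final_def law_append)

text \<open>Only two consecutive configurations enter. By linearity of expectation these terms add
  up to the expected movement of a whole run.\<close>

definition step_cost :: "'a kernel \<Rightarrow> 'a set \<Rightarrow> ('a \<times> 'a set) list \<Rightarrow> 'a \<times> 'a set \<Rightarrow> real" where
  "step_cost K X0 \<sigma> x = measure_pmf.expectation (final K X0 \<sigma>)
     (\<lambda>X. measure_pmf.expectation (K X0 (\<sigma> @ [x]) X) (config_dist X))"

definition cost :: "'a kernel \<Rightarrow> 'a set \<Rightarrow> ('a \<times> 'a set) list \<Rightarrow> real" where
  "cost K X0 \<sigma> = (\<Sum>t<length \<sigma>. step_cost K X0 (take t \<sigma>) (\<sigma> ! t))"

lemma cost_Nil [simp]: "cost K X0 [] = 0"
  by (simp add: cost_def)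

lemma cost_snoc [simp]: "cost K X0 (\<sigma> @ [x]) = cost K X0 \<sigma> + step_cost K X0 \<sigma> x"
  by (simp add: cost_def nth_append)

lemma step_cost_nonneg: "0 \<le> step_cost K X0 \<sigma> x"
  unfolding step_cost_def config_dist_def by (intro Bochner_Integration.integral_nonneg) simp

lemma cost_nonneg: "0 \<le> cost K X0 \<sigma>"
  by (simp add: cost_def sum_nonneg step_cost_nonneg)

text \<open>Only reachable configurations are constrained. \<open>U\<close> may be infinite, so
  finite supports are demanded explicitly; they turn all expectations into finite sums.\<close>

definition serving :: "'a set \<Rightarrow> nat \<Rightarrow> 'a kernel \<Rightarrow> bool" where
  "serving U k K \<longleftrightarrow>
     (\<forall>X0 \<in> configs U k. \<forall>\<sigma> \<in> lists (U \<times> configs U k). \<forall>x \<in> U \<times> configs U k.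
        \<forall>X \<in> set_pmf (final K X0 \<sigma>). finite (set_pmf (K X0 (\<sigma> @ [x]) X)) \<and>
          (\<forall>Y \<in> set_pmf (K X0 (\<sigma> @ [x]) X). Y \<in> configs U k \<and> fst x \<in> Y))"

lemma serving_step:
  assumes "serving U k K" "X0 \<in> configs U k" "\<sigma> \<in> lists (U \<times> configs U k)" "x \<in> U \<times> configs U k"
    "X \<in> set_pmf (final K X0 \<sigma>)"
  shows "finite (set_pmf (K X0 (\<sigma> @ [x]) X))"
    "Y \<in> set_pmf (K X0 (\<sigma> @ [x]) X) \<Longrightarrow> Y \<in> configs U k \<and> fst x \<in> Y"
  using assms unfolding serving_def by metis+

lemma final_serving:
  assumes "serving U k K" "X0 \<in> configs U k" "\<sigma> \<in> lists (U \<times> configs U k)"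
  shows "finite (set_pmf (final K X0 \<sigma>)) \<and> set_pmf (final K X0 \<sigma>) \<subseteq> configs U k"
  using assms(3)
proof (induction \<sigma> rule: rev_induct)
  case Nil
  then show ?case using assms by simp
next
  case (snoc x \<sigma>)
  have \<sigma>: "\<sigma> \<in> lists (U \<times> configs U k)" "x \<in> U \<times> configs U k"
    using snoc.prems by auto
  then have "finite (set_pmf (final K X0 \<sigma>))" using snoc.IH by blast
  moreover note serving_step[OF assms(1,2) \<sigma>]
  ultimately show ?case by (simp add: UN_least subsetI)
qed

lemma final_serves_last:
  assumes "serving U k K" "X0 \<in> configs U k" "\<sigma> \<in> lists (U \<times> configs U k)" "x \<in> U \<times> configs U k"
    "Y \<in> set_pmf (final K X0 (\<sigma> @ [x]))"
  shows "Y \<in> configs U k \<and> fst x \<in> Y"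
  using assms serving_step(2)[OF assms(1-4)] by auto

section \<open>Expectations over finitely supported laws\<close>

lemma expectation_bind_finite:
  fixes h :: "'b \<Rightarrow> real"
  assumes "finite (set_pmf p)" "\<And>x. x \<in> set_pmf p \<Longrightarrow> finite (set_pmf (f x))"
  shows "measure_pmf.expectation (bind_pmf p f) h =
    measure_pmf.expectation p (\<lambda>x. measure_pmf.expectation (f x) h)"
  using assms by (subst pmf_expectation_bind[of "set_pmf p"]) (auto simp: integral_measure_pmf[of "set_pmf p"])

lemma expectation_le_const:
  fixes f :: "'b \<Rightarrow> real"
  assumes "finite (set_pmf p)" "\<And>x. x \<in> set_pmf p \<Longrightarrow> f x \<le> c"
  shows "measure_pmf.expectation p f \<le> c"
  using measure_pmf.integral_le_const[of p f c] assms
  by (auto simp: integrable_measure_pmf_finite AE_measure_pmf_iff)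

lemma expectation_eq_const:
  fixes f :: "'b \<Rightarrow> real"
  assumes "\<And>x. x \<in> set_pmf p \<Longrightarrow> f x = c"
  shows "measure_pmf.expectation p f = c"
proof -
  have "measure_pmf.expectation p f = measure_pmf.expectation p (\<lambda>_. c)"
    using assms by (intro integral_cong_AE) (auto simp: AE_measure_pmf_iff)
  then show ?thesis by simp
qed

lemma expectation_mono_finite:
  fixes f g :: "'b \<Rightarrow> real"
  assumes "finite (set_pmf p)" "\<And>x. x \<in> set_pmf p \<Longrightarrow> f x \<le> g x"
  shows "measure_pmf.expectation p f \<le> measure_pmf.expectation p g"
  using assms by (intro integral_mono_AE) (auto simp: integrable_measure_pmf_finite AE_measure_pmf_iff)

section \<open>From kernels to online algorithms\<close>

lemma movement_cost_snoc:
  "movement_cost ((Y # Ys) @ [X]) = movement_cost (Y # Ys) + config_dist (last (Y # Ys)) X"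
proof -
  have "(Y # Ys @ [X]) ! t = (Y # Ys) ! t" if "t \<le> length Ys" for t
    using that nth_append[of "Y # Ys" "[X]" t] by simp
  then show ?thesis
    unfolding movement_cost_def by (cases Ys rule: rev_cases) (simp_all add: nth_append)
qed

lemma movement_cost_append:
  "movement_cost (Y # Ys @ Zs) = movement_cost (Y # Ys) + movement_cost (last (Y # Ys) # Zs)"
proof (induction Zs rule: rev_induct)
  case Nil
  then show ?case by (simp add: movement_cost_def)
next
  case (snoc Z Zs)
  then show ?case
    using movement_cost_snoc[of Y "Ys @ Zs" Z] movement_cost_snoc[of "last (Y # Ys)" Zs Z]
    by auto
qed

text \<open>A run starts with \<open>X0\<close>, so the head of the history supplies the kernel's
  initial configuration.\<close>

definition alg_of :: "'a kernel \<Rightarrow> 'a online_alg" where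
  "alg_of K Xs \<sigma> = K (hd Xs) \<sigma> (last Xs)"

lemma run_append: "t \<le> length \<sigma> \<Longrightarrow> run A X0 (\<sigma> @ \<tau>) t = run A X0 \<sigma> t"
  by (induction t) (auto intro!: bind_pmf_cong)

lemma run_hd: "Xs \<in> set_pmf (run A X0 \<sigma> t) \<Longrightarrow> Xs \<noteq> [] \<and> hd Xs = X0 \<and> length Xs = Suc t"
  by (induction t arbitrary: Xs) auto

text \<open>The kernel reads only the head and the last entry of the history, and the head is always
  \<open>X0\<close>. Hence the last entries form a Markov chain.\<close>

lemma run_last: "map_pmf last (run (alg_of K) X0 \<sigma> t) = law K X0 \<sigma> t"
proof (induction t)
  case (Suc t)
  have "map_pmf last (run (alg_of K) X0 \<sigma> (Suc t)) =
    bind_pmf (run (alg_of K) X0 \<sigma> t) (\<lambda>Xs. K (hd Xs) (take (Suc t) \<sigma>) (last Xs))"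
    by (simp add: map_bind_pmf pmf.map_comp o_def alg_of_def)
  also have "\<dots> = bind_pmf (run (alg_of K) X0 \<sigma> t) (\<lambda>Xs. K X0 (take (Suc t) \<sigma>) (last Xs))"
    by (intro bind_pmf_cong) (auto dest: run_hd)
  also have "\<dots> = law K X0 \<sigma> (Suc t)"
    by (simp add: Suc.IH[symmetric] bind_map_pmf)
  finally show ?case .
qed auto

lemma run_snoc:
  "run A X0 (\<sigma> @ [x]) (length (\<sigma> @ [x])) =
     bind_pmf (run A X0 \<sigma> (length \<sigma>)) (\<lambda>Xs. map_pmf (\<lambda>X. Xs @ [X]) (A Xs (\<sigma> @ [x])))"
  by (simp add: run_append)

text \<open>The three claims share one induction: finite support makes the costs integrable, and
  appending a configuration adds its \<open>step_cost\<close> in expectation.\<close>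

lemma run_serving:
  assumes K: "serving U k K" "X0 \<in> configs U k" and "\<sigma> \<in> lists (U \<times> configs U k)"
  shows "finite (set_pmf (run (alg_of K) X0 \<sigma> (length \<sigma>))) \<and>
    (\<forall>Xs \<in> set_pmf (run (alg_of K) X0 \<sigma> (length \<sigma>)). serves U k (map fst \<sigma>) (tl Xs)) \<and>
    expected_cost (alg_of K) X0 \<sigma> = cost K X0 \<sigma>"
  using assms(3)
proof (induction \<sigma> rule: rev_induct)
  case Nil
  then show ?case by (simp add: serves_def expected_cost_def movement_cost_def)
next
  case (snoc x \<sigma>)
  let ?R = "run (alg_of K) X0 \<sigma> (length \<sigma>)"
  let ?S = "\<lambda>Xs. map_pmf (\<lambda>X. Xs @ [X]) (alg_of K Xs (\<sigma> @ [x]))"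
  have \<sigma>: "\<sigma> \<in> lists (U \<times> configs U k)" "x \<in> U \<times> configs U k" using snoc.prems by auto
  note IH = snoc.IH[OF \<sigma>(1)]
  have last: "set_pmf (final K X0 \<sigma>) = last ` set_pmf ?R"
    unfolding final_def run_last[symmetric] by simp
  have hd: "Xs \<noteq> []" "alg_of K Xs (\<sigma> @ [x]) = K X0 (\<sigma> @ [x]) (last Xs)" "last Xs \<in> set_pmf (final K X0 \<sigma>)"
    if "Xs \<in> set_pmf ?R" for Xs
    using run_hd[OF that] that last by (auto simp: alg_of_def)
  have sv: "finite (set_pmf (alg_of K Xs (\<sigma> @ [x])))"
    "\<And>Y. Y \<in> set_pmf (alg_of K Xs (\<sigma> @ [x])) \<Longrightarrow> Y \<in> configs U k \<and> fst x \<in> Y"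
    if "Xs \<in> set_pmf ?R" for Xs
    using hd(2,3)[OF that] serving_step[OF K \<sigma>] by auto
  have finR: "finite (set_pmf ?R)" using IH by blast
  have fin: "finite (set_pmf (bind_pmf ?R ?S))"
    using finR sv(1) by simp
  have eq: "measure_pmf.expectation (?S Xs) movement_cost = movement_cost Xs +
      measure_pmf.expectation (K X0 (\<sigma> @ [x]) (last Xs)) (config_dist (last Xs))"
    if Xs: "Xs \<in> set_pmf ?R" for Xs
  proof -
    obtain Y Ys where "Xs = Y # Ys" using hd(1)[OF Xs] by (cases Xs) auto
    then have "movement_cost (Xs @ [X]) = movement_cost Xs + config_dist (last Xs) X" for X
      using movement_cost_snoc[of Y Ys X] by simp
    then show ?thesis
      using sv(1)[OF Xs] hd(2)[OF Xs] by (simp add: integrable_measure_pmf_finite)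
  qed
  have "expected_cost (alg_of K) X0 (\<sigma> @ [x]) = measure_pmf.expectation (bind_pmf ?R ?S) movement_cost"
    unfolding expected_cost_def run_snoc ..
  also have "\<dots> = measure_pmf.expectation ?R (\<lambda>Xs. measure_pmf.expectation (?S Xs) movement_cost)"
    using finR sv(1) by (intro expectation_bind_finite) simp_all
  also have "\<dots> = measure_pmf.expectation ?R (\<lambda>Xs. movement_cost Xs +
      measure_pmf.expectation (K X0 (\<sigma> @ [x]) (last Xs)) (config_dist (last Xs)))"
    by (intro integral_cong_AE) (simp_all add: AE_measure_pmf_iff eq del: integral_map_pmf)
  also have "\<dots> = expected_cost (alg_of K) X0 \<sigma> + measure_pmf.expectation (map_pmf last ?R)
      (\<lambda>X. measure_pmf.expectation (K X0 (\<sigma> @ [x]) X) (config_dist X))"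
    using finR by (simp add: integrable_measure_pmf_finite expected_cost_def)
  also have "\<dots> = cost K X0 (\<sigma> @ [x])"
    using IH unfolding run_last by (simp add: step_cost_def final_def)
  finally have "expected_cost (alg_of K) X0 (\<sigma> @ [x]) = cost K X0 (\<sigma> @ [x])" .
  moreover have "serves U k (map fst (\<sigma> @ [x])) (tl Xs)" if "Xs \<in> set_pmf (bind_pmf ?R ?S)" for Xs
  proof -
    obtain Ys X where Ys: "Ys \<in> set_pmf ?R" "Xs = Ys @ [X]" "X \<in> set_pmf (alg_of K Ys (\<sigma> @ [x]))"
      using \<open>Xs \<in> _\<close> by auto
    have "serves U k (map fst \<sigma>) (tl Ys)" using IH Ys(1) by blast
    then show ?thesis
      using sv(2)[OF Ys(1,3)] hd(1)[OF Ys(1)] Ys(2) by (simp add: serves_def list_all2_appendI)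
  qed
  ultimately show ?case using fin unfolding run_snoc by (intro conjI ballI) simp_all
qed

corollary caching_alg_of: "serving U k K \<Longrightarrow> caching_alg U k (alg_of K)"
  unfolding caching_alg_def proof (intro ballI)
  fix X0 \<sigma> Xs
  assume "serving U k K" "X0 \<in> configs U k" "\<sigma> \<in> lists (U \<times> configs U k)"
    and Xs: "Xs \<in> set_pmf (run (alg_of K) X0 \<sigma> (length \<sigma>))"
  from run_serving[OF this(1-3)] Xs show "serves U k (map fst \<sigma>) (tl Xs)"
    by (elim conjE bspec)
qed

section \<open>Following the cheaper of two algorithms\<close>

lemma sum_powers: "(\<Sum>m<n. 2 * (2 ^ m * c)) = 2 * (2 ^ n - 1) * (c::real)"
  by (induction n) (auto simp: algebra_simps)

text \<open>Level \<open>n\<close> has the budget \<open>2 ^ n * real k\<close>. Choosing by parity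
  makes any two consecutive levels test both algorithms.\<close>

definition pick :: "nat \<Rightarrow> 'a kernel \<Rightarrow> 'a kernel \<Rightarrow> 'a kernel" where
  "pick n K0 K1 = (if even n then K0 else K1)"

text \<open>A switch to another algorithm draws its configuration afresh from that algorithm's law, which
  depends on the input only.\<close>

definition level :: "nat \<Rightarrow> 'a kernel \<Rightarrow> 'a kernel \<Rightarrow> 'a set \<Rightarrow> ('a \<times> 'a set) list \<Rightarrow> nat" where
  "level k K0 K1 X0 \<sigma> = (LEAST n. cost (pick n K0 K1) X0 \<sigma> \<le> 2 ^ n * real k)"

text \<open>The previous level is recomputed from \<open>butlast \<sigma>\<close>, so the
  combination is again a kernel, without extra memory.\<close>

definition combine :: "nat \<Rightarrow> 'a kernel \<Rightarrow> 'a kernel \<Rightarrow> 'a kernel" where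
  "combine k K0 K1 X0 \<sigma> X =
     (let n = level k K0 K1 X0 \<sigma> in
      if level k K0 K1 X0 (butlast \<sigma>) = n then pick n K0 K1 X0 \<sigma> X
      else final (pick n K0 K1) X0 \<sigma>)"

context
  fixes k :: nat and K0 K1 :: "'a kernel" and X0 :: "'a set"
  assumes k: "1 \<le> k"
begin

lemma cost_level: "cost (pick (level k K0 K1 X0 \<sigma>) K0 K1) X0 \<sigma> \<le> 2 ^ level k K0 K1 X0 \<sigma> * real k"
  unfolding level_def
proof (rule LeastI_ex)
  obtain n where n: "max (cost K0 X0 \<sigma>) (cost K1 X0 \<sigma>) < 2 ^ n"
    using real_arch_pow[of 2 "max (cost K0 X0 \<sigma>) (cost K1 X0 \<sigma>)"] by auto
  have "(2::real) ^ n * 1 \<le> 2 ^ n * real k"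
    using k by (intro mult_left_mono) auto
  then have "cost K0 X0 \<sigma> \<le> 2 ^ n * real k" "cost K1 X0 \<sigma> \<le> 2 ^ n * real k"
    using n by linarith+
  then show "\<exists>n. cost (pick n K0 K1) X0 \<sigma> \<le> 2 ^ n * real k"
    by (intro exI[of _ n]) (simp only: pick_def split: if_split, blast)
qed

lemma cost_less_level:
  "m < level k K0 K1 X0 \<sigma> \<Longrightarrow> 2 ^ m * real k < cost (pick m K0 K1) X0 \<sigma>"
  unfolding level_def by (drule not_less_Least) simp

lemma level_Nil [simp]: "level k K0 K1 X0 [] = 0"
  unfolding level_def by (rule Least_eq_0) simp

text \<open>Costs only grow along the input, so a level whose budget suffices after \<open>x\<close>
  also sufficed before.\<close>

lemma level_mono: "level k K0 K1 X0 \<sigma> \<le> level k K0 K1 X0 (\<sigma> @ [x])"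
proof -
  define n where "n = level k K0 K1 X0 (\<sigma> @ [x])"
  have "cost (pick n K0 K1) X0 (\<sigma> @ [x]) \<le> 2 ^ n * real k"
    unfolding n_def by (rule cost_level)
  then have "cost (pick n K0 K1) X0 \<sigma> \<le> 2 ^ n * real k"
    using step_cost_nonneg[of "pick n K0 K1" X0 \<sigma> x] unfolding cost_snoc by linarith
  then have "level k K0 K1 X0 \<sigma> \<le> n"
    unfolding level_def by (rule Least_le)
  then show ?thesis unfolding n_def .
qed

text \<open>An unchanged level continues the chain of the same algorithm; a changed level redraws
  from the new algorithm's law and forgets the old configuration. Either way the picked algorithm
  seems to have run from the start.\<close>

lemma final_combine:
  "final (combine k K0 K1) X0 \<sigma> = final (pick (level k K0 K1 X0 \<sigma>) K0 K1) X0 \<sigma>"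
proof (induction \<sigma> rule: rev_induct)
  case (snoc x \<sigma>)
  show ?case
  proof (cases "level k K0 K1 X0 \<sigma> = level k K0 K1 X0 (\<sigma> @ [x])")
    case True
    then have "combine k K0 K1 X0 (\<sigma> @ [x]) = pick (level k K0 K1 X0 \<sigma>) K0 K1 X0 (\<sigma> @ [x])"
      by (simp add: fun_eq_iff combine_def)
    then show ?thesis using snoc unfolding final_snoc True by simp
  next
    case False
    then have "combine k K0 K1 X0 (\<sigma> @ [x]) =
        (\<lambda>_. final (pick (level k K0 K1 X0 (\<sigma> @ [x])) K0 K1) X0 (\<sigma> @ [x]))"
      unfolding combine_def Let_def by (simp add: fun_eq_iff)
    then have "final (combine k K0 K1) X0 (\<sigma> @ [x]) =
        bind_pmf (final (combine k K0 K1) X0 \<sigma>)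
          (\<lambda>_. final (pick (level k K0 K1 X0 (\<sigma> @ [x])) K0 K1) X0 (\<sigma> @ [x]))"
      by (metis final_snoc)
    then show ?thesis by (simp only: bind_pmf_const)
  qed
qed simp

context
  fixes U :: "'a set"
  assumes K0: "serving U k K0" and K1: "serving U k K1" and X0: "X0 \<in> configs U k"
begin

lemma serving_pick: "serving U k (pick n K0 K1)"
  using K0 K1 by (simp add: pick_def)

text \<open>By \<open>final_combine\<close>, a reachable configuration is reachable for the picked
  algorithm too, so continuing serves the request; a fresh draw serves it by
  \<open>final_serves_last\<close>.\<close>

lemma combine_step:
  assumes "\<sigma> \<in> lists (U \<times> configs U k)" "x \<in> U \<times> configs U k"
    "X \<in> set_pmf (final (combine k K0 K1) X0 \<sigma>)"
  shows "finite (set_pmf (combine k K0 K1 X0 (\<sigma> @ [x]) X))"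
    "Y \<in> set_pmf (combine k K0 K1 X0 (\<sigma> @ [x]) X) \<Longrightarrow> Y \<in> configs U k \<and> fst x \<in> Y"
proof -
  define n where "n = level k K0 K1 X0 (\<sigma> @ [x])"
  have \<sigma>x: "\<sigma> @ [x] \<in> lists (U \<times> configs U k)" using assms(1,2) by simp
  have "finite (set_pmf (combine k K0 K1 X0 (\<sigma> @ [x]) X)) \<and>
    (\<forall>Y \<in> set_pmf (combine k K0 K1 X0 (\<sigma> @ [x]) X). Y \<in> configs U k \<and> fst x \<in> Y)"
  proof (cases "level k K0 K1 X0 \<sigma> = n")
    case True
    have "X \<in> set_pmf (final (pick n K0 K1) X0 \<sigma>)"
      using assms(3) unfolding final_combine True .
    note serving_step[OF serving_pick X0 assms(1,2) this]
    moreover have "combine k K0 K1 X0 (\<sigma> @ [x]) X = pick n K0 K1 X0 (\<sigma> @ [x]) X"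
      by (simp add: combine_def True flip: n_def)
    ultimately show ?thesis by (intro conjI ballI) simp_all
  next
    case False
    then have "combine k K0 K1 X0 (\<sigma> @ [x]) X = final (pick n K0 K1) X0 (\<sigma> @ [x])"
      by (simp add: combine_def flip: n_def)
    then show ?thesis
      using final_serving[OF serving_pick X0 \<sigma>x, of n]
        final_serves_last[OF serving_pick X0 assms(1,2), of _ n]
      by (intro conjI ballI) (simp_all del: final_snoc)
  qed
  then show "finite (set_pmf (combine k K0 K1 X0 (\<sigma> @ [x]) X))"
    "Y \<in> set_pmf (combine k K0 K1 X0 (\<sigma> @ [x]) X) \<Longrightarrow> Y \<in> configs U k \<and> fst x \<in> Y"
    by simp_all
qed

text \<open>At most the \<open>k\<close> cached pages leave in one step. This bounds the price of a
  switch.\<close>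

lemma step_cost_le:
  assumes "\<sigma> \<in> lists (U \<times> configs U k)" "x \<in> U \<times> configs U k"
  shows "step_cost (combine k K0 K1) X0 \<sigma> x \<le> real k"
  unfolding step_cost_def
proof (rule expectation_le_const)
  note fin = final_serving[OF serving_pick[of "level k K0 K1 X0 \<sigma>"] X0 assms(1), folded final_combine]
  show "finite (set_pmf (final (combine k K0 K1) X0 \<sigma>))" using fin by blast
  fix X assume X: "X \<in> set_pmf (final (combine k K0 K1) X0 \<sigma>)"
  then have "finite X" "card X = k" using fin by (auto simp: configs_def)
  then have "config_dist X Y \<le> real k" for Y
    unfolding config_dist_def by (metis Diff_subset card_mono of_nat_le_iff)
  then show "measure_pmf.expectation (combine k K0 K1 X0 (\<sigma> @ [x]) X) (config_dist X) \<le> real k"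
    by (intro expectation_le_const combine_step(1)[OF assms X])
qed

text \<open>A level \<open>m\<close> that was left cost at most its budget
  \<open>2 ^ m * real k\<close> plus one switch. The current level is charged the full cost of its
  algorithm since the start of the input.\<close>

lemma cost_combine_level:
  assumes "\<sigma> \<in> lists (U \<times> configs U k)"
  shows "cost (combine k K0 K1) X0 \<sigma> \<le>
    (\<Sum>m<level k K0 K1 X0 \<sigma>. 2 * (2 ^ m * real k)) + cost (pick (level k K0 K1 X0 \<sigma>) K0 K1) X0 \<sigma>"
  using assms
proof (induction \<sigma> rule: rev_induct)
  case Nil
  show ?case by simp
next
  case (snoc x \<sigma>)
  let ?n = "level k K0 K1 X0 \<sigma>" and ?n' = "level k K0 K1 X0 (\<sigma> @ [x])"
  have \<sigma>: "\<sigma> \<in> lists (U \<times> configs U k)" "x \<in> U \<times> configs U k" using snoc.prems by auto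
  note IH = snoc.IH[OF \<sigma>(1)]
  show ?case
  proof (cases "?n = ?n'")
    case True
    then have "step_cost (combine k K0 K1) X0 \<sigma> x = step_cost (pick ?n K0 K1) X0 \<sigma> x"
      unfolding step_cost_def final_combine by (simp add: combine_def)
    then show ?thesis using IH True by simp
  next
    case False
    then have less: "?n < ?n'" using level_mono[of \<sigma> x] by simp
    have "cost (combine k K0 K1) X0 (\<sigma> @ [x]) \<le>
        (\<Sum>m<?n. 2 * (2 ^ m * real k)) + 2 ^ ?n * real k + real k"
      using IH cost_level[of \<sigma>] step_cost_le[OF \<sigma>] by simp
    \<comment> \<open>The switch costs at most \<open>k\<close>, hence at most another budget; this
      is the factor 2 in the summands.\<close>
    also have "\<dots> \<le> (\<Sum>m<Suc ?n. 2 * (2 ^ m * real k))"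
      using mult_right_mono[of 1 "2 ^ ?n" "real k"] by (simp add: mult.commute)
    \<comment> \<open>Levels may be skipped; their summands are nonnegative.\<close>
    also have "\<dots> \<le> (\<Sum>m<?n'. 2 * (2 ^ m * real k))"
      using less by (intro sum_mono2) auto
    finally show ?thesis using cost_nonneg[of "pick ?n' K0 K1" X0 "\<sigma> @ [x]"] by linarith
  qed
qed

text \<open>The combination has paid at most \<open>3 * 2 ^ n * k\<close> at level \<open>n\<close>.
  For \<open>n \<ge> 2\<close> the budgets of levels \<open>n - 2\<close> and \<open>n - 1\<close>,
  one for each algorithm, are both exceeded, so both costs are above \<open>2 ^ (n - 2) * k\<close>;
  this gives the factor 12. Levels 0 and 1 give the additive \<open>6 * k\<close>.\<close>

lemma cost_combine_min:
  assumes "\<sigma> \<in> lists (U \<times> configs U k)"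
  shows "cost (combine k K0 K1) X0 \<sigma> \<le> 12 * min (cost K0 X0 \<sigma>) (cost K1 X0 \<sigma>) + 6 * real k"
proof -
  define n where "n = level k K0 K1 X0 \<sigma>"
  have le: "cost (combine k K0 K1) X0 \<sigma> \<le> 3 * (2 ^ n * real k)"
    using cost_combine_level[OF assms] cost_level[of \<sigma>]
    unfolding sum_powers n_def[symmetric] by (simp add: algebra_simps)
  have nonneg: "0 \<le> min (cost K0 X0 \<sigma>) (cost K1 X0 \<sigma>)"
    by (simp add: cost_nonneg)
  show ?thesis
  proof (cases "n < 2")
    case True
    then have "n = 0 \<or> n = 1" by auto
    then have "3 * (2 ^ n * real k) \<le> 6 * real k" by auto
    then show ?thesis using le nonneg by linarith
  next
    case False
    define m where "m = n - 2"
    have m: "n = Suc (Suc m)" using False by (simp add: m_def)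
    have "2 ^ m * real k < cost (pick m K0 K1) X0 \<sigma>"
      "2 ^ Suc m * real k < cost (pick (Suc m) K0 K1) X0 \<sigma>"
      using cost_less_level[of m \<sigma>] cost_less_level[of "Suc m" \<sigma>] m n_def by simp_all
    moreover have "2 ^ m * real k \<le> 2 ^ Suc m * real k" by simp
    ultimately have "2 ^ m * real k \<le> cost (pick m K0 K1) X0 \<sigma>"
      "2 ^ m * real k \<le> cost (pick (Suc m) K0 K1) X0 \<sigma>" by linarith+
    then have "2 ^ m * real k \<le> min (cost K0 X0 \<sigma>) (cost K1 X0 \<sigma>)"
      by (cases "even m") (simp_all add: pick_def)
    moreover have "3 * (2 ^ n * real k) = 12 * (2 ^ m * real k)" by (simp add: m)
    ultimately show ?thesis using le by linarith
  qed
qed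

end

end

lemma serving_combine:
  assumes "1 \<le> k" "serving U k K0" "serving U k K1"
  shows "serving U k (combine k K0 K1)"
  unfolding serving_def by (intro ballI conjI combine_step[OF assms])

section \<open>Randomized marking on a fixed base\<close>

text \<open>\<open>R\<close> holds the marked pages before \<open>r\<close> is added. The uniform
  choice is meaningful only if an unmarked page exists on a fault, which the lemmas below assume or
  derive.\<close>

definition serve :: "'a set \<Rightarrow> 'a \<Rightarrow> 'a set \<Rightarrow> 'a set pmf" where
  "serve R r X = (if r \<in> X then return_pmf X
     else map_pmf (\<lambda>u. insert r (X - {u})) (pmf_of_set (X - R)))"

text \<open>\<open>Q\<close> is the base and \<open>R\<close> the set of pages requested in the
  block. Uniformity of the cached part of \<open>Q - R\<close> is encoded as invariance under
  swapping two of its pages, a form that passes through a step by equivariance.\<close>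

definition spread :: "nat \<Rightarrow> 'a set \<Rightarrow> 'a set \<Rightarrow> 'a set pmf \<Rightarrow> bool" where
  "spread k Q R \<mu> \<longleftrightarrow> finite Q \<and> card Q = k \<and> finite R \<and>
     (\<forall>X \<in> set_pmf \<mu>. R \<subseteq> X \<and> X \<subseteq> Q \<union> R \<and> card X = k) \<and>
     (\<forall>p \<in> Q - R. \<forall>q \<in> Q - R. map_pmf ((`) (Transposition.transpose p q)) \<mu> = \<mu>)"

lemma spread_finite: "spread k Q R \<mu> \<Longrightarrow> finite (set_pmf \<mu>)"
  by (rule finite_subset[of _ "Pow (Q \<union> R)"]) (auto simp: spread_def)

lemma spread_return: "finite Q \<Longrightarrow> card Q = k \<Longrightarrow> spread k Q {} (return_pmf Q)"
  by (auto simp: spread_def)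

lemma set_serve:
  assumes "finite X" "r \<notin> X \<Longrightarrow> X - R \<noteq> {}"
  shows "set_pmf (serve R r X) = (if r \<in> X then {X} else (\<lambda>u. insert r (X - {u})) ` (X - R))"
  using assms by (simp add: serve_def)

text \<open>A step depends on \<open>X\<close> only through membership of \<open>r\<close> and a
  uniform choice from \<open>X - R\<close>, so it commutes with relabelling pages as long as
  \<open>r\<close> and the set \<open>R\<close> stay fixed.\<close>

lemma serve_equivariant:
  assumes "bij \<pi>" "\<pi> ` R = R" "\<pi> r = r" "finite X" "r \<notin> X \<Longrightarrow> X - R \<noteq> {}"
  shows "map_pmf ((`) \<pi>) (serve R r X) = serve R r (\<pi> ` X)"
proof -
  have inj: "inj \<pi>" using assms(1) by (rule bij_is_inj)
  then have r: "r \<in> \<pi> ` X \<longleftrightarrow> r \<in> X" using assms(3) by (metis inj_image_mem_iff)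
  show ?thesis
  proof (cases "r \<in> X")
    case True
    then show ?thesis using r by (simp add: serve_def)
  next
    case False
    have "\<pi> ` (insert r (X - {u})) = insert r (\<pi> ` X - {\<pi> u})" for u
      using inj assms(3) by (simp add: image_set_diff)
    then have "map_pmf ((`) \<pi>) (serve R r X) =
        map_pmf (\<lambda>v. insert r (\<pi> ` X - {v})) (map_pmf \<pi> (pmf_of_set (X - R)))"
      using False by (simp add: serve_def pmf.map_comp o_def)
    also have "map_pmf \<pi> (pmf_of_set (X - R)) = pmf_of_set (\<pi> ` X - R)"
      using inj assms False
      by (subst map_pmf_of_set_inj) (auto simp: inj_on_def image_set_diff)
    finally show ?thesis using False r by (simp add: serve_def)
  qed
qed

text \<open>If \<open>r\<close> is missing, it is not in \<open>R\<close>, so \<open>R\<close> has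
  fewer than \<open>k\<close> pages and cannot fill the cache: a page to evict exists.\<close>

lemma spread_nonempty:
  assumes "spread k Q R \<mu>" "r \<in> R \<or> card R < k" "X \<in> set_pmf \<mu>"
  shows "finite X" "R \<subseteq> X" "X \<subseteq> Q \<union> R" "card X = k" "r \<notin> X \<Longrightarrow> X - R \<noteq> {}"
proof -
  show X: "R \<subseteq> X" "X \<subseteq> Q \<union> R" "card X = k" "finite X"
    using assms(1,3) by (auto simp: spread_def intro: finite_subset)
  show "X - R \<noteq> {}" if "r \<notin> X"
  proof -
    have "card R < card X" using that X assms(2) by auto
    then have "X \<noteq> R" by auto
    then show ?thesis using X by blast
  qed
qed

text \<open>A swap of two pages of \<open>Q - insert r R\<close> fixes \<open>r\<close> and
  \<open>R\<close>, so it can be moved through the step onto \<open>\<mu>\<close>, which absorbs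
  it.\<close>

lemma spread_serve:
  assumes \<mu>: "spread k Q R \<mu>" and R: "r \<in> R \<or> card R < k"
  shows "spread k Q (insert r R) (bind_pmf \<mu> (serve R r))"
  unfolding spread_def
proof (intro conjI ballI)
  show "finite Q" "card Q = k" "finite (insert r R)" using \<mu> by (auto simp: spread_def)
next
  fix Y assume "Y \<in> set_pmf (bind_pmf \<mu> (serve R r))"
  then obtain X where X: "X \<in> set_pmf \<mu>" "Y \<in> set_pmf (serve R r X)" by auto
  note X' = spread_nonempty[OF \<mu> R X(1)]
  consider "r \<in> X" "Y = X" | u where "r \<notin> X" "u \<in> X - R" "Y = insert r (X - {u})"
    using X(2) by (auto simp: set_serve[OF X'(1,5)] split: if_splits)
  then have "insert r R \<subseteq> Y \<and> Y \<subseteq> Q \<union> insert r R \<and> card Y = k"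
  proof cases
    case 1
    then show ?thesis using X' by auto
  next
    case (2 u)
    then have "card Y = Suc (card (X - {u}))" using X'(1) by simp
    also have "\<dots> = k" using 2 X'(1,4) card_Suc_Diff1[of X u] by simp
    finally show ?thesis using 2 X' by auto
  qed
  then show "insert r R \<subseteq> Y" "Y \<subseteq> Q \<union> insert r R" "card Y = k" by auto
next
  fix p q assume pq: "p \<in> Q - insert r R" "q \<in> Q - insert r R"
  let ?\<pi> = "Transposition.transpose p q"
  have R': "?\<pi> ` R = R"
    using pq by (intro transpose_image_eq) auto
  have "map_pmf ((`) ?\<pi>) (bind_pmf \<mu> (serve R r)) = bind_pmf \<mu> (\<lambda>X. serve R r (?\<pi> ` X))"
    unfolding map_bind_pmf
    by (intro bind_pmf_cong refl serve_equivariant R' spread_nonempty[OF \<mu> R])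
      (use pq in auto)
  also have "\<dots> = bind_pmf (map_pmf ((`) ?\<pi>) \<mu>) (serve R r)"
    by (simp add: bind_map_pmf)
  also have "map_pmf ((`) ?\<pi>) \<mu> = \<mu>"
    using \<mu> pq by (auto simp: spread_def)
  finally show "map_pmf ((`) ?\<pi>) (bind_pmf \<mu> (serve R r)) = bind_pmf \<mu> (serve R r)" .
qed

text \<open>By symmetry all pages of \<open>Q - R\<close> are missing with equal probability, and
  these probabilities sum to the expected number of missing pages.\<close>

lemma spread_miss:
  assumes \<mu>: "spread k Q R \<mu>" and r: "r \<in> Q - R"
  shows "measure_pmf.prob \<mu> {X. r \<notin> X} = real (card (R - Q)) / real (card (Q - R))"
proof -
  have fin: "finite Q" "finite R" "card Q = k" using \<mu> by (auto simp: spread_def)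
  have eq: "measure_pmf.prob \<mu> {X. p \<notin> X} = measure_pmf.prob \<mu> {X. r \<notin> X}" if "p \<in> Q - R" for p
  proof -
    have "map_pmf ((`) (Transposition.transpose p r)) \<mu> = \<mu>" using \<mu> r that by (auto simp: spread_def)
    then have "measure_pmf.prob \<mu> {X. p \<notin> X} = measure_pmf.prob (map_pmf ((`) (Transposition.transpose p r)) \<mu>) {X. p \<notin> X}"
      by simp
    also have "\<dots> = measure_pmf.prob \<mu> {X. r \<notin> X}"
    proof -
      have "p \<in> Transposition.transpose p r ` X \<longleftrightarrow> r \<in> X" for X
        using inj_image_mem_iff[OF inj_on_transpose, of p r r X] by simp
      then show ?thesis by (simp add: measure_map_pmf vimage_def)
    qed
    finally show ?thesis .
  qed
  \<comment> \<open>The number of missing pages is not random: \<open>Q\<close> and \<open>X\<close>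
    both have \<open>k\<close> pages, so \<open>Q - X\<close> is as large as \<open>X - Q\<close>,
    which equals \<open>R - Q\<close>.\<close>
  have count: "(\<Sum>p\<in>Q - R. indicator {X. p \<notin> X} X) = real (card (R - Q))" if X: "X \<in> set_pmf \<mu>" for X
  proof -
    have X': "R \<subseteq> X" "X \<subseteq> Q \<union> R" "card X = k" "finite X"
      using \<mu> X fin by (auto simp: spread_def intro: finite_subset)
    have "(\<Sum>p\<in>Q - R. indicator {X. p \<notin> X} X) = real (card (Q - X))"
    proof -
      have "(\<Sum>p\<in>Q - R. indicator {X. p \<notin> X} X) = (\<Sum>p\<in>Q - R. if p \<notin> X then 1 else (0::real))"
        by (intro sum.cong) auto
      also have "\<dots> = real (card {p \<in> Q - R. p \<notin> X})"
        using fin by (simp add: sum.If_cases Int_def)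
      also have "{p \<in> Q - R. p \<notin> X} = Q - X" using X' by auto
      finally show ?thesis .
    qed
    also have "card (Q - X) = card (X - Q)"
      using card_Diff_subset_Int[of Q X] card_Diff_subset_Int[of X Q] fin X' by (simp add: Int_commute)
    also have "X - Q = R - Q" using X' by auto
    finally show ?thesis .
  qed
  have "real (card (Q - R)) * measure_pmf.prob \<mu> {X. r \<notin> X} = (\<Sum>p\<in>Q - R. measure_pmf.prob \<mu> {X. p \<notin> X})"
    using eq by simp
  also have "\<dots> = (\<Sum>p\<in>Q - R. measure_pmf.expectation \<mu> (indicator {X. p \<notin> X}))"
    by simp
  also have "\<dots> = measure_pmf.expectation \<mu> (\<lambda>X. \<Sum>p\<in>Q - R. indicator {X. p \<notin> X} X)"
    using spread_finite[OF \<mu>] by (subst Bochner_Integration.integral_sum) (auto simp: integrable_measure_pmf_finite)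
  also have "\<dots> = real (card (R - Q))"
    by (rule expectation_eq_const) (rule count)
  finally have "real (card (Q - R)) * measure_pmf.prob \<mu> {X. r \<notin> X} = real (card (R - Q))" .
  moreover have "real (card (Q - R)) \<noteq> 0" using r fin by (auto simp: card_eq_0_iff)
  ultimately show ?thesis by (simp add: field_simps)
qed

text \<open>When the \<open>j\<close>-th page of \<open>Q\<close> is requested, it is missing with probability
  \<open>card (R - Q) / (k - j)\<close>; so this function, which also grows with \<open>card (R - Q)\<close>, pays for the
  faults within a block.\<close>

definition marking_cost :: "nat \<Rightarrow> 'a set \<Rightarrow> 'a set \<Rightarrow> real" where
  "marking_cost k Q R = real (card (R - Q)) * (1 + (\<Sum>j<card (R \<inter> Q). 1 / (real k - real j)))"

lemma serve_dist:
  assumes "finite X" "r \<notin> X \<Longrightarrow> X - R \<noteq> {}"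
  shows "measure_pmf.expectation (serve R r X) (config_dist X) = indicator {X. r \<notin> X} X"
proof (rule expectation_eq_const)
  fix Y assume "Y \<in> set_pmf (serve R r X)"
  then consider "r \<in> X" "Y = X" | u where "r \<notin> X" "u \<in> X - R" "Y = insert r (X - {u})"
    by (auto simp: set_serve[OF assms] split: if_splits)
  then show "config_dist X Y = indicator {X. r \<notin> X} X"
  proof cases
    case (2 u)
    then have "X - Y = {u}" by auto
    then show ?thesis using 2 by (simp add: config_dist_def)
  qed (simp add: config_dist_def)
qed

text \<open>A repeated request never faults. A new base page adds one term to the harmonic sum, and
  the increment is exactly its probability of missing. A new page outside the base increases
  \<open>card (R - Q)\<close>, which raises \<open>marking_cost\<close> by at least 1.\<close>

lemma spread_serve_cost:
  assumes \<mu>: "spread k Q R \<mu>" and R: "r \<in> R \<or> card R < k"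
  shows "measure_pmf.expectation \<mu> (\<lambda>X. measure_pmf.expectation (serve R r X) (config_dist X))
    \<le> marking_cost k Q (insert r R) - marking_cost k Q R"
proof -
  have fin: "finite Q" "finite R" "card Q = k" using \<mu> by (auto simp: spread_def)
  have "measure_pmf.expectation \<mu> (\<lambda>X. measure_pmf.expectation (serve R r X) (config_dist X)) =
      measure_pmf.expectation \<mu> (indicator {X. r \<notin> X})"
    using serve_dist[OF spread_nonempty(1,5)[OF \<mu> R]]
    by (intro integral_cong_AE) (simp_all add: AE_measure_pmf_iff)
  also have "\<dots> = measure_pmf.prob \<mu> {X. r \<notin> X}" by simp
  also have "\<dots> \<le> marking_cost k Q (insert r R) - marking_cost k Q R"
  proof -
    consider "r \<in> R" | "r \<in> Q - R" | "r \<notin> R" "r \<notin> Q" by auto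
    then show ?thesis
    proof cases
      case 1
      then have "set_pmf \<mu> \<inter> {X. r \<notin> X} = {}" using \<mu> by (auto simp: spread_def)
      then have "measure_pmf.prob \<mu> {X. r \<notin> X} = 0" by (simp add: measure_pmf_zero_iff)
      then show ?thesis using 1 by (simp add: insert_absorb)
    next
      case 2
      have "card (R \<inter> Q) < k" using psubset_card_mono[of Q "R \<inter> Q"] fin 2 by auto
      moreover have "card (Q - R) = k - card (R \<inter> Q)"
        using card_Diff_subset_Int[of Q R] fin by (simp add: Int_commute)
      ultimately have unmarked: "real (card (Q - R)) = real k - real (card (R \<inter> Q))" by simp
      have "insert r R - Q = R - Q" "insert r R \<inter> Q = insert r (R \<inter> Q)" using 2 by auto
      moreover have "card (insert r (R \<inter> Q)) = Suc (card (R \<inter> Q))" using 2 fin by simp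
      ultimately show ?thesis
        unfolding spread_miss[OF \<mu> 2] marking_cost_def unmarked by (simp add: algebra_simps)
    next
      case 3
      have "insert r R - Q = insert r (R - Q)" "insert r R \<inter> Q = R \<inter> Q" using 3 by auto
      moreover have "card (insert r (R - Q)) = Suc (card (R - Q))" using 3 fin by simp
      moreover have "0 \<le> (\<Sum>j<card (R \<inter> Q). 1 / (real k - real j))"
      proof (rule sum_nonneg)
        fix j assume "j \<in> {..<card (R \<inter> Q)}"
        moreover have "card (R \<inter> Q) \<le> k" using card_mono[of Q "R \<inter> Q"] fin by auto
        ultimately show "0 \<le> 1 / (real k - real j)" by simp
      qed
      ultimately have "1 \<le> marking_cost k Q (insert r R) - marking_cost k Q R"
        by (simp add: marking_cost_def algebra_simps)
      then show ?thesis
        using measure_pmf.prob_le_1[of \<mu> "{X. r \<notin> X}"] by linarith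
    qed
  qed
  finally show ?thesis .
qed

section \<open>Configuration distances and medoids\<close>

lemma config_dist_commute:
  assumes "X \<in> configs U k" "Y \<in> configs U k"
  shows "config_dist X Y = config_dist Y X"
  using assms card_Diff_subset_Int[of X Y] card_Diff_subset_Int[of Y X]
  by (simp add: configs_def config_dist_def Int_commute)

lemma config_dist_triangle:
  assumes "finite X" "finite Y"
  shows "config_dist X Z \<le> config_dist X Y + config_dist Y Z"
proof -
  have "card (X - Z) \<le> card ((X - Y) \<union> (Y - Z))"
    using assms by (intro card_mono) auto
  also have "\<dots> \<le> card (X - Y) + card (Y - Z)" by (rule card_Un_le)
  finally show ?thesis by (simp add: config_dist_def)
qed

lemma config_dist_nonneg [simp]: "0 \<le> config_dist X Y"
  by (simp add: config_dist_def)

lemma finite_config [simp]: "X \<in> configs U k \<Longrightarrow> finite X"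
  by (simp add: configs_def)

lemma finite_Union_configs: "set Xs \<subseteq> configs U k \<Longrightarrow> finite (\<Union>(set Xs))"
  by (intro finite_Union) auto

section \<open>Pages loaded and evicted along a schedule\<close>

lemma movement_cost_nonneg: "0 \<le> movement_cost Xs"
  by (simp add: movement_cost_def sum_nonneg)

lemma movement_cost_single [simp]: "movement_cost [X] = 0"
  by (simp add: movement_cost_def)

text \<open>A page that occurs in \<open>Ys\<close> but not in \<open>Y\<close> must be loaded at
  some step. The movement cost counts evictions, which equal the loads because all configurations
  have \<open>k\<close> pages.\<close>

lemma movement_loaded:
  assumes "Y \<in> configs U k" "set Ys \<subseteq> configs U k"
  shows "real (card (\<Union>(set Ys) - Y)) \<le> movement_cost (Y # Ys)"
  using assms(2)
proof (induction Ys rule: rev_induct)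
  case (snoc Z Ys)
  let ?L = "last (Y # Ys)"
  have L: "?L \<in> configs U k" using snoc.prems assms(1) by (cases Ys rule: rev_cases) auto
  have fin: "finite (\<Union>(set Ys))" "finite Z"
    using snoc.prems finite_Union_configs[of Ys U k] by auto
  have "?L = Y \<or> ?L \<in> set Ys" by (cases Ys rule: rev_cases) auto
  then have "\<Union>(set (Ys @ [Z])) - Y \<subseteq> (\<Union>(set Ys) - Y) \<union> (Z - ?L)" by auto
  then have "card (\<Union>(set (Ys @ [Z])) - Y) \<le> card ((\<Union>(set Ys) - Y) \<union> (Z - ?L))"
    using fin by (intro card_mono) auto
  also have "\<dots> \<le> card (\<Union>(set Ys) - Y) + card (Z - ?L)" by (rule card_Un_le)
  finally have "real (card (\<Union>(set (Ys @ [Z])) - Y)) \<le>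
      real (card (\<Union>(set Ys) - Y)) + config_dist Z ?L" by (simp add: config_dist_def)
  also have "config_dist Z ?L = config_dist ?L Z"
    using snoc.prems L by (intro config_dist_commute) auto
  finally show ?case using snoc.IH snoc.prems movement_cost_snoc[of Y Ys Z] by simp
qed simp

text \<open>A page that occurs at some time but is absent at the end must have been evicted at some
  step.\<close>

lemma movement_evicted:
  assumes "Y \<in> configs U k" "set Ys \<subseteq> configs U k"
  shows "real (card (\<Union>(set (Y # Ys)) - last (Y # Ys))) \<le> movement_cost (Y # Ys)"
  using assms(2)
proof (induction Ys rule: rev_induct)
  case (snoc Z Ys)
  let ?L = "last (Y # Ys)"
  have L: "finite ?L" using snoc.prems assms(1) by (cases Ys rule: rev_cases) auto
  have fin: "finite (\<Union>(set (Y # Ys)))"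
    using snoc.prems assms(1) finite_Union_configs[of "Y # Ys" U k] by auto
  have "\<Union>(set (Y # Ys @ [Z])) - Z \<subseteq> (\<Union>(set (Y # Ys)) - ?L) \<union> (?L - Z)" by auto
  then have "card (\<Union>(set (Y # Ys @ [Z])) - Z) \<le> card ((\<Union>(set (Y # Ys)) - ?L) \<union> (?L - Z))"
    using fin L by (intro card_mono) auto
  also have "\<dots> \<le> card (\<Union>(set (Y # Ys)) - ?L) + card (?L - Z)" by (rule card_Un_le)
  finally have "real (card (\<Union>(set (Y # Ys @ [Z])) - Z)) \<le>
      real (card (\<Union>(set (Y # Ys)) - ?L)) + config_dist ?L Z" by (simp add: config_dist_def)
  then show ?case using snoc.IH snoc.prems movement_cost_snoc[of Y Ys Z] by simp
qed simp

lemma movement_dist_last: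
  assumes "Y \<in> configs U k" "set Ys \<subseteq> configs U k" "X \<in> set (Y # Ys)"
  shows "config_dist X (last (Y # Ys)) \<le> movement_cost (Y # Ys)"
proof -
  have "config_dist X (last (Y # Ys)) \<le> real (card (\<Union>(set (Y # Ys)) - last (Y # Ys)))"
    unfolding config_dist_def of_nat_le_iff
    using assms finite_Union_configs[of "Y # Ys" U k] by (intro card_mono finite_Diff) auto
  then show ?thesis using movement_evicted[OF assms(1,2)] by linarith
qed

lemma movement_dist:
  assumes "Y \<in> configs U k" "set Ys \<subseteq> configs U k" "X \<in> set (Y # Ys)" "Z \<in> set (Y # Ys)"
  shows "config_dist X Z \<le> movement_cost (Y # Ys)"
  using assms(2-4)
proof (induction Ys arbitrary: X Z rule: rev_induct)
  case (snoc W Ys)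
  let ?L = "last (Y # Ys)"
  have sub: "set Ys \<subseteq> configs U k" "W \<in> configs U k" using snoc.prems by auto
  have L: "?L \<in> configs U k" using sub assms(1) by (cases Ys rule: rev_cases) auto
  have new: "config_dist V W \<le> movement_cost (Y # Ys @ [W])" if "V \<in> set (Y # Ys)" for V
    using movement_dist_last[OF assms(1) snoc.prems(1), of V] that by auto
  have conf: "V \<in> configs U k" if "V \<in> set (Y # Ys)" for V using that sub assms(1) by auto
  have old: "config_dist V V' \<le> movement_cost (Y # Ys @ [W])"
    if "V \<in> set (Y # Ys)" "V' \<in> set (Y # Ys)" for V V'
    using snoc.IH[OF sub(1) that] movement_cost_snoc[of Y Ys W] config_dist_nonneg[of ?L W]
    unfolding append_Cons by linarith
  have W: "config_dist W W \<le> movement_cost (Y # Ys @ [W])"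
    using movement_cost_nonneg by (simp add: config_dist_def)
  have new': "config_dist W V \<le> movement_cost (Y # Ys @ [W])" if "V \<in> set (Y # Ys)" for V
    using new[OF that] config_dist_commute[OF sub(2) conf[OF that]] by simp
  consider "X \<in> set (Y # Ys)" "Z \<in> set (Y # Ys)" | "X \<in> set (Y # Ys)" "Z = W"
    | "X = W" "Z \<in> set (Y # Ys)" | "X = W" "Z = W"
    using snoc.prems(2,3) by auto
  then show ?case using old new new' W by cases auto
qed (simp add: config_dist_def)

lemma prediction_error_append:
  "length Ps = length Os \<Longrightarrow>
    prediction_error (Ps @ Ps') (Os @ Os') = prediction_error Ps Os + prediction_error Ps' Os'"
proof -
  have "(\<Sum>t<m + n. f t) = (\<Sum>t<m. f t) + (\<Sum>t<n. f (m + t))" for m n :: nat and f :: "nat \<Rightarrow> real"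
    by (induction n) simp_all
  then show "length Ps = length Os \<Longrightarrow> ?thesis"
    by (simp add: prediction_error_def nth_append)
qed

lemma prediction_error_nonneg: "0 \<le> prediction_error Ps Os"
  by (simp add: prediction_error_def sum_nonneg)

text \<open>The medoid replaces the (unknown) best prediction of a block: it is at least as central as
  each prediction, hence close to the offline configuration on average.\<close>

definition medoid :: "'a set list \<Rightarrow> 'a set" where
  "medoid Ps = arg_min_on (\<lambda>P. \<Sum>Q\<leftarrow>Ps. config_dist P Q) (set Ps)"

lemma medoid_in: "Ps \<noteq> [] \<Longrightarrow> medoid Ps \<in> set Ps"
  unfolding medoid_def by (intro arg_min_if_finite) auto

text \<open>Let \<open>V\<close> be the offline movement, \<open>\<eta>\<close> the error and
  \<open>m\<close> the number of predictions. Minimality compares the medoid with every prediction;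
  averaging these comparisons bounds its total distance \<open>S\<close> to the predictions by
  \<open>2 * \<eta> + m * V\<close>. Averaging the path from the medoid through
  \<open>Ps ! i\<close> and \<open>Os ! i\<close> to the last configuration adds
  \<open>\<eta> + m * V\<close>.\<close>

lemma medoid_dist:
  assumes Ps: "set Ps \<subseteq> configs U k" "Ps \<noteq> []" "length Os = length Ps"
    and Os: "Y \<in> configs U k" "set Os \<subseteq> configs U k"
  shows "config_dist (medoid Ps) (last (Y # Os)) \<le>
    2 * movement_cost (Y # Os) + 3 / real (length Ps) * prediction_error Ps Os"
proof -
  define m where "m = length Ps"
  define V where "V = movement_cost (Y # Os)"
  define \<eta> where "\<eta> = prediction_error Ps Os"
  define e where "e i = config_dist (Ps ! i) (Os ! i)" for i
  define M where "M = medoid Ps"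
  define S where "S = (\<Sum>i<m. config_dist M (Ps ! i))"
  have m: "0 < m" "length Os = m" using Ps by (auto simp: m_def)
  have P: "Ps ! i \<in> configs U k" "Ps ! i \<in> set Ps" and O: "Os ! i \<in> configs U k" "Os ! i \<in> set (Y # Os)"
    if "i < m" for i
    using Ps Os m that nth_mem[of i Ps] nth_mem[of i Os] by (auto simp: m_def)
  have M: "M \<in> configs U k" using medoid_in Ps by (auto simp: M_def)
  have \<eta>: "(\<Sum>i<m. e i) = \<eta>" by (simp add: e_def \<eta>_def prediction_error_def m_def)
  have S_le: "S \<le> real m * e j + (real m * V + \<eta>)" if j: "j < m" for j
  proof -
    have "(\<Sum>Q\<leftarrow>Ps. config_dist M Q) \<le> (\<Sum>Q\<leftarrow>Ps. config_dist (Ps ! j) Q)"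
      unfolding M_def medoid_def using P(2)[OF j] Ps(2) by (intro arg_min_least) auto
    then have "S \<le> (\<Sum>i<m. config_dist (Ps ! j) (Ps ! i))"
      by (simp add: S_def sum_list_sum_nth m_def atLeast0LessThan)
    also have "\<dots> \<le> (\<Sum>i<m. e j + (V + e i))"
    proof (rule sum_mono)
      fix i assume "i \<in> {..<m}"
      then have i: "i < m" by simp
      have "config_dist (Ps ! j) (Ps ! i) \<le> config_dist (Ps ! j) (Os ! j) + config_dist (Os ! j) (Ps ! i)"
        using P[OF j] O[OF j] by (intro config_dist_triangle) auto
      moreover have "config_dist (Os ! j) (Ps ! i) \<le> config_dist (Os ! j) (Os ! i) + config_dist (Os ! i) (Ps ! i)"
        using O[OF j] O[OF i] by (intro config_dist_triangle) auto
      moreover have "config_dist (Os ! j) (Os ! i) \<le> V"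
        unfolding V_def using O[OF j] O[OF i] by (intro movement_dist[OF Os]) auto
      moreover have "config_dist (Os ! i) (Ps ! i) = e i"
        using P[OF i] O[OF i] config_dist_commute unfolding e_def by metis
      ultimately show "config_dist (Ps ! j) (Ps ! i) \<le> e j + (V + e i)" by (simp add: e_def)
    qed
    also have "\<dots> = real m * e j + (real m * V + \<eta>)"
      by (simp add: sum.distrib \<eta>)
    finally show ?thesis .
  qed
  \<comment> \<open>Summing \<open>S_le\<close> over all \<open>j\<close> replaces the individual
    error \<open>e j\<close> by its average.\<close>
  have "real m * S = (\<Sum>j<m. S)" by simp
  also have "\<dots> \<le> (\<Sum>j<m. real m * e j + (real m * V + \<eta>))"
    using S_le by (intro sum_mono) auto
  also have "\<dots> = real m * (2 * \<eta> + real m * V)"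
    by (simp add: sum.distrib \<eta> algebra_simps flip: sum_distrib_left)
  finally have S: "S \<le> 2 * \<eta> + real m * V" using m by simp
  have "real m * config_dist M (last (Y # Os)) = (\<Sum>i<m. config_dist M (last (Y # Os)))" by simp
  also have "\<dots> \<le> (\<Sum>i<m. config_dist M (Ps ! i) + (e i + V))"
  proof (rule sum_mono)
    fix i assume "i \<in> {..<m}"
    then have i: "i < m" by simp
    have "config_dist M (last (Y # Os)) \<le> config_dist M (Ps ! i) + config_dist (Ps ! i) (last (Y # Os))"
      using M P[OF i] by (intro config_dist_triangle) auto
    moreover have "config_dist (Ps ! i) (last (Y # Os)) \<le> e i + config_dist (Os ! i) (last (Y # Os))"
      unfolding e_def using O[OF i] P[OF i] by (intro config_dist_triangle) auto
    moreover have "config_dist (Os ! i) (last (Y # Os)) \<le> V"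
      unfolding V_def using O[OF i] by (intro movement_dist_last[OF Os]) auto
    ultimately show "config_dist M (last (Y # Os)) \<le> config_dist M (Ps ! i) + (e i + V)" by simp
  qed
  also have "\<dots> = S + \<eta> + real m * V" by (simp add: sum.distrib \<eta> S_def)
  also have "\<dots> \<le> real m * (2 * V + 3 / real m * \<eta>)"
    using S m by (simp add: algebra_simps)
  finally have "config_dist M (last (Y # Os)) \<le> 2 * V + 3 / real m * \<eta>" using m by simp
  then show ?thesis by (simp add: M_def V_def m_def \<eta>_def)
qed

section \<open>The block algorithm\<close>

lemma configsD: "X \<in> configs U k \<Longrightarrow> X \<subseteq> U \<and> finite X \<and> card X = k"
  unfolding configs_def by blast

definition requested :: "('a \<times> 'a set) list \<Rightarrow> 'a set" where
  "requested B = fst ` set B"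

text \<open>The state is the pair of the base and the inputs of the open block. A request that would
  bring the block above \<open>h\<close> distinct pages opens the next one, whose base
  \<open>rule\<close> computes from the finished block.\<close>

definition advance ::
    "nat \<Rightarrow> (('a \<times> 'a set) list \<Rightarrow> 'a set) \<Rightarrow> 'a set \<times> ('a \<times> 'a set) list \<Rightarrow> 'a \<times> 'a set \<Rightarrow>
     'a set \<times> ('a \<times> 'a set) list" where
  "advance h rule s x =
     (if card (insert (fst x) (requested (snd s))) \<le> h then (fst s, snd s @ [x])
      else (rule (snd s), [x]))"

definition block_state ::
    "nat \<Rightarrow> (('a \<times> 'a set) list \<Rightarrow> 'a set) \<Rightarrow> 'a set \<Rightarrow> ('a \<times> 'a set) list \<Rightarrow>
     'a set \<times> ('a \<times> 'a set) list" where
  "block_state h rule X0 \<sigma> = foldl (advance h rule) (X0, []) \<sigma>"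

text \<open>A new block jumps to its base, whatever \<open>X\<close> is, and serves the request from
  there with nothing marked, in a single transition.\<close>

definition block_kernel :: "nat \<Rightarrow> (('a \<times> 'a set) list \<Rightarrow> 'a set) \<Rightarrow> 'a kernel" where
  "block_kernel h rule X0 \<sigma> X =
     (let B = snd (block_state h rule X0 (butlast \<sigma>)); r = fst (last \<sigma>) in
      if card (insert r (requested B)) \<le> h then serve (requested B) r X
      else serve {} r (rule B))"

lemma block_state_Nil [simp]: "block_state h rule X0 [] = (X0, [])"
  by (simp add: block_state_def)

lemma block_state_snoc [simp]:
  "block_state h rule X0 (\<sigma> @ [x]) = advance h rule (block_state h rule X0 \<sigma>) x"
  by (simp add: block_state_def)

lemma requested_snoc [simp]: "requested (B @ [x]) = insert (fst x) (requested B)"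
  by (simp add: requested_def)

lemma requested_Nil [simp]: "requested [] = {}"
  by (simp add: requested_def)

lemma finite_requested [simp]: "finite (requested B)"
  by (simp add: requested_def)

lemma marking_cost_empty [simp]: "marking_cost k Q {} = 0"
  by (simp add: marking_cost_def)

lemma marking_cost_le:
  assumes "h \<le> k" "card R \<le> h" "finite R"
  shows "marking_cost k Q R \<le> (1 + (\<Sum>j<h. 1 / (real k - real j))) * real (card (R - Q))"
proof -
  have "card (R \<inter> Q) \<le> card R" using assms by (intro card_mono) auto
  then have "(\<Sum>j<card (R \<inter> Q). 1 / (real k - real j)) \<le> (\<Sum>j<h. 1 / (real k - real j))"
    using assms by (intro sum_mono2) auto
  then show ?thesis
    unfolding marking_cost_def
    by (subst mult.commute[of _ "real (card (R - Q))"]) (intro mult_left_mono add_left_mono, auto)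
qed

text \<open>\<open>rule\<close> has to return a configuration only on blocks with exactly
  \<open>h\<close> distinct pages: for marking, \<open>requested B\<close> has size \<open>k\<close>
  only then.\<close>

locale block_algorithm =
  fixes U :: "'a set" and k h :: nat and rule :: "('a \<times> 'a set) list \<Rightarrow> 'a set" and X0 :: "'a set"
  assumes h: "1 \<le> h" "h \<le> k"
    and rule: "\<And>B. \<lbrakk>B \<in> lists (U \<times> configs U k); B \<noteq> []; card (requested B) = h\<rbrakk>
      \<Longrightarrow> rule B \<in> configs U k"
    and X0: "X0 \<in> configs U k"
begin

abbreviation "alg \<equiv> block_kernel h rule"
abbreviation "base \<sigma> \<equiv> fst (block_state h rule X0 \<sigma>)"
abbreviation "block \<sigma> \<equiv> snd (block_state h rule X0 \<sigma>)"

section \<open>Invariants of the block state and of the current law\<close>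

lemma block_state_invariant:
  assumes "\<sigma> \<in> lists (U \<times> configs U k)"
  shows "base \<sigma> \<in> configs U k \<and> block \<sigma> \<in> lists (U \<times> configs U k) \<and>
    card (requested (block \<sigma>)) \<le> h"
  using assms
proof (induction \<sigma> rule: rev_induct)
  case Nil
  then show ?case using X0 by simp
next
  case (snoc x \<sigma>)
  then have IH: "base \<sigma> \<in> configs U k" "block \<sigma> \<in> lists (U \<times> configs U k)"
    "card (requested (block \<sigma>)) \<le> h" and x: "x \<in> U \<times> configs U k"
    by auto
  show ?case
  proof (cases "card (insert (fst x) (requested (block \<sigma>))) \<le> h")
    case True
    then show ?thesis using IH x by (simp add: advance_def)
  next
    case False
    then have full: "card (requested (block \<sigma>)) = h"
      using IH(3) by (simp add: card_insert_if split: if_splits)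
    then have "block \<sigma> \<noteq> []" using h by auto
    then have "rule (block \<sigma>) \<in> configs U k" using rule IH full by blast
    then show ?thesis using False x h by (simp add: advance_def requested_def)
  qed
qed

text \<open>One request adds at most one distinct page, so an overflowing block had exactly
  \<open>h\<close> of them.\<close>

lemma new_block:
  assumes "\<sigma> \<in> lists (U \<times> configs U k)" "h < card (insert (fst x) (requested (block \<sigma>)))"
  shows "card (requested (block \<sigma>)) = h" "block \<sigma> \<noteq> []" "rule (block \<sigma>) \<in> configs U k"
proof -
  note inv = block_state_invariant[OF assms(1)]
  show full: "card (requested (block \<sigma>)) = h"
    using inv assms(2) by (simp add: card_insert_if split: if_splits)
  then show ne: "block \<sigma> \<noteq> []" using h by auto
  show "rule (block \<sigma>) \<in> configs U k" using inv rule ne full by blast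
qed

lemma block_kernel_same:
  "card (insert (fst x) (requested (block \<sigma>))) \<le> h \<Longrightarrow>
    alg X0 (\<sigma> @ [x]) = serve (requested (block \<sigma>)) (fst x)"
  by (simp add: block_kernel_def fun_eq_iff)

lemma block_kernel_new:
  "h < card (insert (fst x) (requested (block \<sigma>))) \<Longrightarrow>
    alg X0 (\<sigma> @ [x]) = (\<lambda>_. serve {} (fst x) (rule (block \<sigma>)))"
  by (simp add: block_kernel_def fun_eq_iff)

text \<open>This is the side condition of \<open>spread_serve\<close>. It follows from
  \<open>h \<le> k\<close>: \<open>k\<close> marked pages leave no room for another one in the
  block.\<close>

lemma same_block_room:
  assumes "card (insert r (requested B)) \<le> h"
  shows "r \<in> requested B \<or> card (requested B) < k"
proof (rule disjCI)
  assume "\<not> card (requested B) < k"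
  then have "card (insert r (requested B)) \<le> card (requested B)" using assms h by linarith
  then show "r \<in> requested B" by (metis card_insert_disjoint finite_requested not_less_eq_eq order_refl)
qed

text \<open>Within a block this is \<open>spread_serve\<close>. A new block restarts from the point
  mass at its base, which is spread with no page marked.\<close>

lemma final_spread:
  assumes "\<sigma> \<in> lists (U \<times> configs U k)"
  shows "spread k (base \<sigma>) (requested (block \<sigma>)) (final alg X0 \<sigma>)"
  using assms
proof (induction \<sigma> rule: rev_induct)
  case Nil
  have "finite X0" "card X0 = k" using configsD[OF X0] by blast+
  then show ?case unfolding block_state_Nil final_Nil fst_conv snd_conv requested_Nil by (rule spread_return)
next
  case (snoc x \<sigma>)
  have \<sigma>: "\<sigma> \<in> lists (U \<times> configs U k)" using snoc.prems by simp
  show ?case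
  proof (cases "card (insert (fst x) (requested (block \<sigma>))) \<le> h")
    case True
    have "final alg X0 (\<sigma> @ [x]) =
        bind_pmf (final alg X0 \<sigma>) (serve (requested (block \<sigma>)) (fst x))"
      unfolding final_snoc block_kernel_same[OF True] ..
    moreover have "base (\<sigma> @ [x]) = base \<sigma>"
      "requested (block (\<sigma> @ [x])) = insert (fst x) (requested (block \<sigma>))"
      using True by (simp_all add: advance_def)
    ultimately show ?thesis
      using spread_serve[OF snoc.IH[OF \<sigma>] same_block_room[OF True]] by simp
  next
    case False
    then have new: "h < card (insert (fst x) (requested (block \<sigma>)))" by simp
    define Q where "Q = rule (block \<sigma>)"
    have "finite Q" "card Q = k" using configsD[OF new_block(3)[OF \<sigma> new]] unfolding Q_def by blast+
    then have "spread k Q {} (return_pmf Q)" by (rule spread_return)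
    then have "spread k Q {fst x} (bind_pmf (return_pmf Q) (serve {} (fst x)))"
      using spread_serve[of k Q "{}" "return_pmf Q" "fst x"] h by simp
    moreover have "final alg X0 (\<sigma> @ [x]) = bind_pmf (return_pmf Q) (serve {} (fst x))"
      unfolding final_snoc block_kernel_new[OF new] by (simp add: bind_return_pmf Q_def)
    moreover have "base (\<sigma> @ [x]) = Q" "requested (block (\<sigma> @ [x])) = {fst x}"
      using new by (simp_all add: advance_def Q_def requested_def)
    ultimately show ?thesis by simp
  qed
qed

lemma serving_block:
  assumes "\<sigma> \<in> lists (U \<times> configs U k)" "x \<in> U \<times> configs U k" "X \<in> set_pmf (final alg X0 \<sigma>)"
  shows "finite (set_pmf (alg X0 (\<sigma> @ [x]) X)) \<and>
    (\<forall>Y \<in> set_pmf (alg X0 (\<sigma> @ [x]) X). Y \<in> configs U k \<and> fst x \<in> Y)"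
proof -
  have \<sigma>x: "\<sigma> @ [x] \<in> lists (U \<times> configs U k)" using assms by simp
  have sub: "set_pmf (alg X0 (\<sigma> @ [x]) X) \<subseteq> set_pmf (final alg X0 (\<sigma> @ [x]))"
    using assms(3) by auto
  have fin: "finite (set_pmf (alg X0 (\<sigma> @ [x]) X))"
    by (rule finite_subset[OF sub]) (rule spread_finite[OF final_spread[OF \<sigma>x]])
  moreover have "Y \<in> configs U k \<and> fst x \<in> Y" if "Y \<in> set_pmf (alg X0 (\<sigma> @ [x]) X)" for Y
  proof -
    have Y: "Y \<in> set_pmf (final alg X0 (\<sigma> @ [x]))" using that sub by blast
    then have "requested (block (\<sigma> @ [x])) \<subseteq> Y" "Y \<subseteq> base (\<sigma> @ [x]) \<union> requested (block (\<sigma> @ [x]))"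
      "card Y = k" using final_spread[OF \<sigma>x] unfolding spread_def by blast+
    moreover have "base (\<sigma> @ [x]) \<in> configs U k" "requested (block (\<sigma> @ [x])) \<subseteq> U"
      using block_state_invariant[OF \<sigma>x] by (auto simp: requested_def)
    moreover have "fst x \<in> requested (block (\<sigma> @ [x]))"
      by (simp add: advance_def requested_def)
    moreover have "finite Y"
      using calculation(2,4) finite_subset[OF _ finite_UnI[OF finite_config finite_requested]] by blast
    ultimately show ?thesis unfolding configs_def by blast
  qed
  ultimately show ?thesis by blast
qed

lemma step_cost_same:
  assumes "\<sigma> \<in> lists (U \<times> configs U k)" "card (insert (fst x) (requested (block \<sigma>))) \<le> h"
  shows "step_cost alg X0 \<sigma> x \<le>
    marking_cost k (base \<sigma>) (insert (fst x) (requested (block \<sigma>))) -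
    marking_cost k (base \<sigma>) (requested (block \<sigma>))"
  unfolding step_cost_def block_kernel_same[OF assms(2)]
  by (rule spread_serve_cost[OF final_spread[OF assms(1)] same_block_room[OF assms(2)]])

text \<open>The move is split at \<open>Q'\<close>. A page of \<open>X - Q'\<close> is a requested
  page outside the old base or an old base page outside \<open>Q'\<close>; the rest is the first
  request of the new block.\<close>

lemma step_cost_new:
  assumes "\<sigma> \<in> lists (U \<times> configs U k)" "h < card (insert (fst x) (requested (block \<sigma>)))"
  defines "Q' \<equiv> rule (block \<sigma>)"
  shows "step_cost alg X0 \<sigma> x \<le>
    real (card (requested (block \<sigma>) - base \<sigma>)) + config_dist (base \<sigma>) Q' + marking_cost k Q' {fst x}"
proof -
  note inv = block_state_invariant[OF assms(1)]
  note spread = final_spread[OF assms(1)]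
  have fin_base: "finite (base \<sigma>)" by (rule finite_config[OF conjunct1[OF inv]])
  have Q': "finite Q'" "card Q' = k" using configsD[OF new_block(3)[OF assms(1,2)]] unfolding Q'_def by blast+
  have "Q' \<noteq> {}" using Q'(2) h by (metis card.empty not_one_le_zero order_trans)
  then have finite_serve: "finite (set_pmf (serve {} (fst x) Q'))"
    using Q'(1) by (simp add: set_serve)
  have "fst x \<in> {} \<or> card {} < k" using h by simp
  from spread_serve_cost[OF spread_return[OF Q'] this]
  have serve_cost: "measure_pmf.expectation (serve {} (fst x) Q') (config_dist Q') \<le> marking_cost k Q' {fst x}"
    by simp
  show ?thesis
    unfolding step_cost_def block_kernel_new[OF assms(2), folded Q'_def]
  proof (rule expectation_le_const[OF spread_finite[OF spread]])
    fix X assume "X \<in> set_pmf (final alg X0 \<sigma>)"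
    then have X: "X \<subseteq> base \<sigma> \<union> requested (block \<sigma>)" using spread by (auto simp: spread_def)
    have "finite (base \<sigma> \<union> requested (block \<sigma>))" using fin_base by simp
    with X have finX: "finite X" by (rule finite_subset)
    have "X - Q' \<subseteq> (requested (block \<sigma>) - base \<sigma>) \<union> (base \<sigma> - Q')" using X by auto
    then have "card (X - Q') \<le> card ((requested (block \<sigma>) - base \<sigma>) \<union> (base \<sigma> - Q'))"
      using fin_base by (intro card_mono) simp_all
    also have "\<dots> \<le> card (requested (block \<sigma>) - base \<sigma>) + card (base \<sigma> - Q')" by (rule card_Un_le)
    finally have jump: "config_dist X Q' \<le>
        real (card (requested (block \<sigma>) - base \<sigma>)) + config_dist (base \<sigma>) Q'"
      by (simp add: config_dist_def)
    have "measure_pmf.expectation (serve {} (fst x) Q') (config_dist X) \<le>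
        measure_pmf.expectation (serve {} (fst x) Q') (\<lambda>Y. config_dist X Q' + config_dist Q' Y)"
      by (intro expectation_mono_finite finite_serve config_dist_triangle finX Q'(1))
    also have "\<dots> = config_dist X Q' + measure_pmf.expectation (serve {} (fst x) Q') (config_dist Q')"
      using finite_serve by (simp add: integrable_measure_pmf_finite)
    finally show "measure_pmf.expectation (serve {} (fst x) Q') (config_dist X) \<le>
        real (card (requested (block \<sigma>) - base \<sigma>)) + config_dist (base \<sigma>) Q' + marking_cost k Q' {fst x}"
      using jump serve_cost by linarith
  qed
qed

text \<open>The factor between the faults of a block and \<open>card (R - Q)\<close>. It is at most
  2 for \<open>h = (k + 1) div 2\<close>, and one plus the \<open>k\<close>-th harmonic number for
  \<open>h = k\<close>.\<close>

definition gain :: real where "gain = 1 + (\<Sum>j<h. 1 / (real k - real j))"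

lemma gain_ge: "1 \<le> gain"
  unfolding gain_def using h by (auto intro!: sum_nonneg)

section \<open>Comparison with the offline schedule\<close>

lemma serves_requested:
  assumes "serves U k (map fst B) Os"
  shows "length Os = length B" "set Os \<subseteq> configs U k" "requested B \<subseteq> \<Union>(set Os)"
proof -
  show len: "length Os = length B" using assms by (auto simp: serves_def dest: list_all2_lengthD)
  have at: "fst (B ! i) \<in> Os ! i" "Os ! i \<in> configs U k" if "i < length B" for i
    using assms that len by (auto simp: serves_def list_all2_conv_all_nth)
  show "set Os \<subseteq> configs U k" using at len by (auto simp: in_set_conv_nth)
  show "requested B \<subseteq> \<Union>(set Os)"
  proof
    fix r assume "r \<in> requested B"
    then obtain i where "i < length B" "r = fst (B ! i)"
      by (auto simp: requested_def in_set_conv_nth)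
    then show "r \<in> \<Union>(set Os)" using at(1)[of i] len nth_mem[of i Os] by (metis UnionI)
  qed
qed

text \<open>The offline schedule holds every requested page at some time, so one outside
  \<open>Q\<close> is either already in \<open>Y\<close> or loaded during the block.\<close>

lemma requested_outside_le:
  assumes "serves U k (map fst B) Os" "Y \<in> configs U k" "Q \<in> configs U k"
  shows "real (card (requested B - Q)) \<le> config_dist Q Y + movement_cost (Y # Os)"
proof -
  note s = serves_requested[OF assms(1)]
  have "requested B - Q \<subseteq> (\<Union>(set Os) - Y) \<union> (Y - Q)" using s(3) by auto
  then have "card (requested B - Q) \<le> card ((\<Union>(set Os) - Y) \<union> (Y - Q))"
    using finite_Union_configs[OF s(2)] assms by (intro card_mono) auto
  also have "\<dots> \<le> card (\<Union>(set Os) - Y) + card (Y - Q)" by (rule card_Un_le)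
  finally have "real (card (requested B - Q)) \<le> real (card (\<Union>(set Os) - Y)) + config_dist Y Q"
    by (simp add: config_dist_def)
  then show ?thesis
    using movement_loaded[OF assms(2) s(2)] config_dist_commute[OF assms(2,3)] by linarith
qed

text \<open>Amortization with the potential \<open>gain + 2\<close> times the distance from the base
  to the offline configuration at the start of the block. \<open>\<sigma>1\<close> and
  \<open>Os1\<close> cover the completed blocks. \<open>Os2\<close> serves the open block, whose
  online cost is held in \<open>marking_cost\<close> until its offline cost is counted.\<close>

lemma block_potential:
  assumes \<kappa>: "0 \<le> \<kappa>"
    and close: "\<And>B Y Os. \<lbrakk>B \<in> lists (U \<times> configs U k); card (requested B) = h; Y \<in> configs U k;
        serves U k (map fst B) Os\<rbrakk> \<Longrightarrow>
        config_dist (rule B) (last (Y # Os)) \<le>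
          2 * movement_cost (Y # Os) + \<kappa> * prediction_error (map snd B) Os"
    and "\<sigma> \<in> lists (U \<times> configs U k)" "serves U k (map fst \<sigma>) Os"
  shows "\<exists>\<sigma>1 Os1 Os2. \<sigma> = \<sigma>1 @ block \<sigma> \<and> Os = Os1 @ Os2 \<and> length Os1 = length \<sigma>1 \<and>
    serves U k (map fst (block \<sigma>)) Os2 \<and> last (X0 # Os1) \<in> configs U k \<and>
    cost alg X0 \<sigma> + (gain + 2) * config_dist (base \<sigma>) (last (X0 # Os1)) \<le>
      (3 * gain + 8) * movement_cost (X0 # Os1) +
      (gain + 3) * \<kappa> * prediction_error (map snd \<sigma>1) Os1 +
      marking_cost k (base \<sigma>) (requested (block \<sigma>))"
  using assms(3,4)
proof (induction \<sigma> arbitrary: Os rule: rev_induct)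
  case Nil
  then show ?case
    using X0 by (intro exI[of _ "[]"]) (auto simp: serves_def config_dist_def prediction_error_def)
next
  case (snoc x \<sigma>)
  obtain Os' Z where Os: "Os = Os' @ [Z]" and Os': "serves U k (map fst \<sigma>) Os'"
    and Z: "Z \<in> configs U k" "fst x \<in> Z"
    using snoc.prems(2) by (auto simp: serves_def list_all2_append1 list_all2_Cons1)
  have \<sigma>: "\<sigma> \<in> lists (U \<times> configs U k)" using snoc.prems by simp
  note inv = block_state_invariant[OF \<sigma>]
  obtain \<sigma>1 Os1 Os2 where IH: "\<sigma> = \<sigma>1 @ block \<sigma>" "Os' = Os1 @ Os2" "length Os1 = length \<sigma>1"
    "serves U k (map fst (block \<sigma>)) Os2" "last (X0 # Os1) \<in> configs U k"
    and pot: "cost alg X0 \<sigma> + (gain + 2) * config_dist (base \<sigma>) (last (X0 # Os1)) \<le>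
      (3 * gain + 8) * movement_cost (X0 # Os1) +
      (gain + 3) * \<kappa> * prediction_error (map snd \<sigma>1) Os1 +
      marking_cost k (base \<sigma>) (requested (block \<sigma>))"
    using snoc.IH[OF \<sigma> Os'] by blast
  have Z_serves: "serves U k [fst x] [Z]" using Z by (simp add: serves_def)
  show ?case
  proof (cases "card (insert (fst x) (requested (block \<sigma>))) \<le> h")
    case True
    then have state: "block (\<sigma> @ [x]) = block \<sigma> @ [x]" "base (\<sigma> @ [x]) = base \<sigma>"
      by (simp_all add: advance_def)
    have "serves U k (map fst (block \<sigma> @ [x])) (Os2 @ [Z])"
      using IH(4) Z_serves by (auto simp: serves_def intro!: list_all2_appendI)
    \<comment> \<open>The split stays in place; \<open>marking_cost\<close> grows by at least the
      cost of the step.\<close>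
    then show ?thesis
      unfolding state
      using IH Os pot step_cost_same[OF \<sigma> True]
      by (intro exI[of _ \<sigma>1] exI[of _ Os1] exI[of _ "Os2 @ [Z]"])
        (auto simp del: last.simps)
  next
    case False
    then have new: "h < card (insert (fst x) (requested (block \<sigma>)))" by simp
    define Q' where "Q' = rule (block \<sigma>)"
    define Q where "Q = base \<sigma>"
    define Y where "Y = last (X0 # Os1)"
    define Y' where "Y' = last (X0 # Os')"
    define N where "N = real (card (requested (block \<sigma>) - Q))"
    define V where "V = movement_cost (Y # Os2)"
    define e where "e = prediction_error (map snd (block \<sigma>)) Os2"
    have state: "block (\<sigma> @ [x]) = [x]" "base (\<sigma> @ [x]) = Q'"
      using False by (simp_all add: advance_def Q'_def)
    note blk = serves_requested[OF IH(4)]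
    have Y: "Y \<in> configs U k" using IH by (simp add: Y_def)
    have Y'_eq: "Y' = last (Y # Os2)" by (simp add: Y'_def Y_def IH(2))
    have Y': "Y' \<in> configs U k"
      using Y blk(2) last_in_set[of "Y # Os2"] unfolding Y'_eq by auto
    have Q: "Q \<in> configs U k" using inv by (simp add: Q_def)
    have Q': "Q' \<in> configs U k" using new_block(3)[OF \<sigma> new] by (simp add: Q'_def)
    have N: "N \<le> config_dist Q Y + V"
      unfolding N_def V_def by (rule requested_outside_le[OF IH(4) Y Q])
    have mark: "marking_cost k Q (requested (block \<sigma>)) \<le> gain * N"
      unfolding gain_def N_def using h inv by (intro marking_cost_le) auto
    have d': "config_dist Q' Y' \<le> 2 * V + \<kappa> * e"
      unfolding Q'_def Y'_eq V_def e_def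
      using close inv new_block(1)[OF \<sigma> new] Y IH(4) by blast
    have "config_dist Q Q' \<le> config_dist Q Y + config_dist Y Q'"
      using Q Y by (intro config_dist_triangle) auto
    moreover have "config_dist Y Q' \<le> config_dist Y Y' + config_dist Y' Q'"
      using Y Y' by (intro config_dist_triangle) auto
    moreover have "config_dist Y Y' \<le> V"
      unfolding V_def Y'_eq by (rule movement_dist_last[OF Y blk(2)]) simp
    moreover have "config_dist Y' Q' = config_dist Q' Y'"
      using Y' Q' by (rule config_dist_commute)
    ultimately have QQ': "config_dist Q Q' \<le> config_dist Q Y + V + config_dist Q' Y'" by linarith
    have step: "step_cost alg X0 \<sigma> x \<le> N + config_dist Q Q' + marking_cost k Q' {fst x}"
      unfolding N_def Q_def Q'_def by (rule step_cost_new[OF \<sigma> new])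
    have mov: "movement_cost (X0 # Os') = movement_cost (X0 # Os1) + V"
      unfolding V_def Y_def IH(2) by (rule movement_cost_append)
    have err: "prediction_error (map snd \<sigma>) Os' = prediction_error (map snd \<sigma>1) Os1 + e"
      unfolding e_def IH(2) by (subst IH(1)) (simp add: prediction_error_append IH(3))
    have gN: "(gain + 1) * N \<le> (gain + 1) * (config_dist Q Y + V)"
      using N gain_ge by (intro mult_left_mono) auto
    have gd: "(gain + 3) * config_dist Q' Y' \<le> (gain + 3) * (2 * V + \<kappa> * e)"
      using d' gain_ge by (intro mult_left_mono) auto
    \<comment> \<open>With \<open>D\<close>, \<open>D'\<close> the distances from \<open>Q\<close>
      to \<open>Y\<close> and from \<open>Q'\<close> to \<open>Y'\<close>, the closed block and the
      jump cost at most \<open>(gain + 2) * (D + V) + D'\<close>. The old potential pays for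
      \<open>D\<close>. With the new potential, \<open>D'\<close> has coefficient
      \<open>gain + 3\<close>, and \<open>D' \<le> 2 * V + \<kappa> * e\<close>. So \<open>V\<close>
      gets \<open>(gain + 2) + 2 * (gain + 3) = 3 * gain + 8\<close>.\<close>
    have "cost alg X0 (\<sigma> @ [x]) + (gain + 2) * config_dist Q' Y' \<le>
        (3 * gain + 8) * movement_cost (X0 # Os') + (gain + 3) * \<kappa> * prediction_error (map snd \<sigma>) Os' +
        marking_cost k Q' {fst x}"
      using pot step mark gN gd QQ' unfolding mov err Q_def[symmetric] Y_def[symmetric] cost_snoc
      by (simp add: algebra_simps)
    then show ?thesis
      unfolding state
      using Os Os' Y' Z_serves serves_requested(1)[OF Os']
      by (intro exI[of _ \<sigma>] exI[of _ Os'] exI[of _ "[Z]"])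
        (auto simp: Y'_def requested_def simp del: last.simps)
  qed
qed

text \<open>The block still open at the end costs at most \<open>gain\<close> times the sum of the
  base distance and its offline movement. The potential pays the first part, and the coefficient
  \<open>3 * gain + 8\<close> covers the second.\<close>

theorem block_cost:
  assumes \<kappa>: "0 \<le> \<kappa>"
    and close: "\<And>B Y Os. \<lbrakk>B \<in> lists (U \<times> configs U k); card (requested B) = h; Y \<in> configs U k;
        serves U k (map fst B) Os\<rbrakk> \<Longrightarrow>
        config_dist (rule B) (last (Y # Os)) \<le>
          2 * movement_cost (Y # Os) + \<kappa> * prediction_error (map snd B) Os"
    and \<sigma>: "\<sigma> \<in> lists (U \<times> configs U k)" and Os: "serves U k (map fst \<sigma>) Os"
  shows "cost alg X0 \<sigma> \<le> (3 * gain + 8) * movement_cost (X0 # Os) +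
    (gain + 3) * \<kappa> * prediction_error (map snd \<sigma>) Os"
proof -
  obtain \<sigma>1 Os1 Os2 where dec: "\<sigma> = \<sigma>1 @ block \<sigma>" "Os = Os1 @ Os2" "length Os1 = length \<sigma>1"
    "serves U k (map fst (block \<sigma>)) Os2" "last (X0 # Os1) \<in> configs U k"
    and pot: "cost alg X0 \<sigma> + (gain + 2) * config_dist (base \<sigma>) (last (X0 # Os1)) \<le>
      (3 * gain + 8) * movement_cost (X0 # Os1) +
      (gain + 3) * \<kappa> * prediction_error (map snd \<sigma>1) Os1 +
      marking_cost k (base \<sigma>) (requested (block \<sigma>))"
    using block_potential[OF assms] by blast
  note inv = block_state_invariant[OF \<sigma>]
  define Y where "Y = last (X0 # Os1)"
  define V where "V = movement_cost (Y # Os2)"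
  define e where "e = prediction_error (map snd (block \<sigma>)) Os2"
  define N where "N = real (card (requested (block \<sigma>) - base \<sigma>))"
  have N: "N \<le> config_dist (base \<sigma>) Y + V"
    unfolding N_def V_def Y_def by (rule requested_outside_le[OF dec(4,5) conjunct1[OF inv]])
  have "marking_cost k (base \<sigma>) (requested (block \<sigma>)) \<le> gain * N"
    unfolding gain_def N_def using h inv by (intro marking_cost_le) auto
  also have "\<dots> \<le> gain * (config_dist (base \<sigma>) Y + V)"
    using N gain_ge by (intro mult_left_mono) auto
  finally have mark: "marking_cost k (base \<sigma>) (requested (block \<sigma>)) \<le> gain * (config_dist (base \<sigma>) Y + V)" .
  have V: "gain * V \<le> (3 * gain + 8) * V"
    unfolding V_def using gain_ge by (intro mult_right_mono movement_cost_nonneg) auto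
  have e: "0 \<le> (gain + 3) * \<kappa> * e"
    unfolding e_def using gain_ge \<kappa> by (intro mult_nonneg_nonneg prediction_error_nonneg) auto
  have mov: "movement_cost (X0 # Os) = movement_cost (X0 # Os1) + V"
    unfolding V_def Y_def dec(2) by (rule movement_cost_append)
  have err: "prediction_error (map snd \<sigma>) Os = prediction_error (map snd \<sigma>1) Os1 + e"
    unfolding e_def dec(2) by (subst dec(1)) (simp add: prediction_error_append dec(3))
  show ?thesis
    using pot mark V e config_dist_nonneg[of "base \<sigma>" Y]
    unfolding mov err Y_def[symmetric] by (simp add: algebra_simps del: config_dist_nonneg)
qed

end

section \<open>The two instances\<close>

lemma serving_block_kernel:
  assumes "\<And>X0. X0 \<in> configs U k \<Longrightarrow> block_algorithm U k h rule X0"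
  shows "serving U k (block_kernel h rule)"
  unfolding serving_def by (intro ballI block_algorithm.serving_block[OF assms])

text \<open>Half of \<open>k\<close> rounded up: large enough that \<open>1 / h \<le> 2 / k\<close>
  in the error term, small enough that \<open>k - j \<ge> h\<close> for all
  \<open>j < h\<close>.\<close>

abbreviation follow :: "nat \<Rightarrow> 'a kernel" where
  "follow k \<equiv> block_kernel ((k + 1) div 2) (\<lambda>B. medoid (map snd B))"

abbreviation marking :: "nat \<Rightarrow> 'a kernel" where
  "marking k \<equiv> block_kernel k requested"

lemma predictions_in_configs:
  "B \<in> lists (U \<times> configs U k) \<Longrightarrow> set (map snd B) \<subseteq> configs U k"
  by auto

lemma block_algorithm_follow:
  assumes "1 \<le> k" "X0 \<in> configs U k"
  shows "block_algorithm U k ((k + 1) div 2) (\<lambda>B. medoid (map snd B)) X0"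
proof
  show "1 \<le> (k + 1) div 2" "(k + 1) div 2 \<le> k" using assms(1) by auto
  show "X0 \<in> configs U k" by fact
  fix B :: "('a \<times> 'a set) list" assume B: "B \<in> lists (U \<times> configs U k)" "B \<noteq> []"
  have "medoid (map snd B) \<in> set (map snd B)" using B(2) by (intro medoid_in) simp
  then show "medoid (map snd B) \<in> configs U k" using predictions_in_configs[OF B(1)] by blast
qed

lemma block_algorithm_marking:
  assumes "1 \<le> k" "X0 \<in> configs U k"
  shows "block_algorithm U k k requested X0"
proof
  show "1 \<le> k" "k \<le> k" using assms(1) by auto
  show "X0 \<in> configs U k" by fact
  fix B :: "('a \<times> 'a set) list" assume B: "B \<in> lists (U \<times> configs U k)" "card (requested B) = k"
  have "requested B \<subseteq> U" using B(1) by (auto simp: requested_def)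
  then show "requested B \<in> configs U k" using B(2) unfolding configs_def by simp
qed

text \<open>With \<open>gain \<le> 2\<close> and \<open>\<kappa> = 3 / h\<close>, the constants are
  \<open>3 * 2 + 8 = 14\<close> and \<open>(2 + 3) * 3 / h \<le> 30 / k\<close>.\<close>

lemma cost_follow:
  assumes k: "1 \<le> k" and X0: "X0 \<in> configs U k" and \<sigma>: "\<sigma> \<in> lists (U \<times> configs U k)"
    and Os: "serves U k (map fst \<sigma>) Os"
  shows "cost (follow k) X0 \<sigma> \<le>
    14 * movement_cost (X0 # Os) + 30 / real k * prediction_error (map snd \<sigma>) Os"
proof -
  define h where "h = (k + 1) div 2"
  have hk: "1 \<le> h" "real k \<le> 2 * real h" "2 * real h \<le> real k + 1"
    using k by (auto simp: h_def)
  interpret block_algorithm U k h "\<lambda>B. medoid (map snd B)" X0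
    unfolding h_def by (rule block_algorithm_follow[OF k X0])
  have "(\<Sum>j<h. 1 / (real k - real j)) \<le> (\<Sum>j<h. 1 / real h)"
  proof (rule sum_mono)
    fix j assume "j \<in> {..<h}"
    then have "real j + 1 \<le> real h" by auto
    then have "real h \<le> real k - real j" using hk by linarith
    then show "1 / (real k - real j) \<le> 1 / real h" using hk by (intro divide_left_mono) auto
  qed
  also have "\<dots> = 1" using hk by simp
  finally have gain: "gain \<le> 2" by (simp add: gain_def)
  have close: "config_dist (medoid (map snd B)) (last (Y # Ys)) \<le>
      2 * movement_cost (Y # Ys) + 3 / real h * prediction_error (map snd B) Ys"
    if B: "B \<in> lists (U \<times> configs U k)" "card (requested B) = h" and Y: "Y \<in> configs U k"
      and Ys: "serves U k (map fst B) Ys" for B Y Ys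
  proof -
    \<comment> \<open>A block with \<open>h\<close> distinct pages carries at least \<open>h\<close>
      predictions over which the error is averaged.\<close>
    have "h \<le> length B" using card_image_le[of "set B" fst] card_length[of B] B(2)
      by (simp add: requested_def)
    then have len: "real h \<le> real (length B)" "B \<noteq> []" using hk by auto
    note s = serves_requested[OF Ys]
    have "config_dist (medoid (map snd B)) (last (Y # Ys)) \<le>
        2 * movement_cost (Y # Ys) + 3 / real (length (map snd B)) * prediction_error (map snd B) Ys"
      using len(2) s(1) by (intro medoid_dist[OF predictions_in_configs[OF B(1)] _ _ Y s(2)]) simp_all
    also have "3 / real (length (map snd B)) * prediction_error (map snd B) Ys \<le>
        3 / real h * prediction_error (map snd B) Ys"
      using len hk by (intro mult_right_mono prediction_error_nonneg divide_left_mono) auto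
    finally show ?thesis by simp
  qed
  have "cost alg X0 \<sigma> \<le> (3 * gain + 8) * movement_cost (X0 # Os) +
      (gain + 3) * (3 / real h) * prediction_error (map snd \<sigma>) Os"
    by (rule block_cost[OF _ close \<sigma> Os]) simp_all
  also have "(3 * gain + 8) * movement_cost (X0 # Os) \<le> 14 * movement_cost (X0 # Os)"
    using gain by (intro mult_right_mono movement_cost_nonneg) auto
  also have "(gain + 3) * (3 / real h) * prediction_error (map snd \<sigma>) Os \<le>
      30 / real k * prediction_error (map snd \<sigma>) Os"
  proof (intro mult_right_mono prediction_error_nonneg)
    have "(gain + 3) * (3 / real h) \<le> 5 * (3 / real h)"
      using gain by (intro mult_right_mono) auto
    also have "\<dots> \<le> 30 / real k" using hk k by (simp add: field_simps)
    finally show "(gain + 3) * (3 / real h) \<le> 30 / real k" .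
  qed
  finally show ?thesis by (simp add: h_def)
qed

text \<open>The difference of \<open>harm n\<close> and \<open>ln n\<close> decreases from its value
  1 at \<open>n = 1\<close>.\<close>

lemma harm_le_ln: "1 \<le> k \<Longrightarrow> harm k \<le> 1 + ln (real k)"
  using decseqD[OF decseq_harm_diff_ln, of 0 "k - 1"] by (simp add: harm_def)

lemma cost_marking:
  assumes k: "2 \<le> k" and X0: "X0 \<in> configs U k" and \<sigma>: "\<sigma> \<in> lists (U \<times> configs U k)"
    and Os: "serves U k (map fst \<sigma>) Os"
  shows "cost (marking k) X0 \<sigma> \<le> 24 * ln (real k) * movement_cost (X0 # Os)"
proof -
  have k1: "1 \<le> k" using k by simp
  interpret block_algorithm U k k requested X0
    by (rule block_algorithm_marking[OF k1 X0])
  \<comment> \<open>Reversing the order of summation turns the denominators \<open>k, ..., 1\<close>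
    into \<open>1, ..., k\<close>.\<close>
  have "(\<Sum>j<k. 1 / (real k - real j)) = (\<Sum>j<k. inverse (real (Suc j)))"
    by (subst sum.nat_diff_reindex[symmetric], intro sum.cong)
      (auto simp: of_nat_diff Suc_diff_Suc inverse_eq_divide)
  also have "\<dots> = harm k" by (simp add: harm_altdef)
  finally have gain: "gain \<le> 2 + ln (real k)" using harm_le_ln[OF k1] by (simp add: gain_def)
  have "ln (2::real) \<le> ln (real k)" using k by simp
  then have ln: "2 / 3 \<le> ln (real k)" using ln2_ge_two_thirds by linarith
  \<comment> \<open>A page requested in the block was cached offline, so if it is absent at the end
    it was evicted. No prediction enters, hence \<open>\<kappa> = 0\<close>.\<close>
  have close: "config_dist (requested B) (last (Y # Ys)) \<le>
      2 * movement_cost (Y # Ys) + 0 * prediction_error (map snd B) Ys"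
    if Y: "Y \<in> configs U k" and Ys: "serves U k (map fst B) Ys" for B Y Ys
  proof -
    note s = serves_requested[OF Ys]
    have "\<forall>Z \<in> set (Y # Ys). Z \<in> configs U k" using Y s(2) by auto
    then have "finite (\<Union>(set (Y # Ys)))" using finite_Union_configs[of "Y # Ys" U k] by auto
    then have "config_dist (requested B) (last (Y # Ys)) \<le> real (card (\<Union>(set (Y # Ys)) - last (Y # Ys)))"
      unfolding config_dist_def of_nat_le_iff using s(3) by (intro card_mono finite_Diff) auto
    then show ?thesis
      using movement_evicted[OF Y s(2)] movement_cost_nonneg[of "Y # Ys"] by linarith
  qed
  have "cost alg X0 \<sigma> \<le> (3 * gain + 8) * movement_cost (X0 # Os) +
      (gain + 3) * 0 * prediction_error (map snd \<sigma>) Os"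
    by (rule block_cost[OF _ close \<sigma> Os]) simp_all
  also have "\<dots> = (3 * gain + 8) * movement_cost (X0 # Os)" by simp
  \<comment> \<open>\<open>3 * gain + 8 \<le> 14 + 3 * ln k\<close>, and
    \<open>14 \<le> 21 * ln k\<close> because \<open>ln k \<ge> 2 / 3\<close>.\<close>
  also have "\<dots> \<le> 24 * ln (real k) * movement_cost (X0 # Os)"
    using gain ln by (intro mult_right_mono movement_cost_nonneg) linarith
  finally show ?thesis .
qed

lemma ratio_bound:
  fixes Off \<eta> :: real
  assumes k: "2 \<le> k" and nonneg: "0 \<le> Off" "0 \<le> \<eta>"
  shows "min (14 * Off + 30 / real k * \<eta>) (24 * ln (real k) * Off) \<le>
    60 * min (1 + ln (1 + \<eta> / Off)) (ln (real k)) * Off"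
proof (cases "Off = 0")
  case False
  define x where "x = \<eta> / (real k * Off)"
  have Off: "0 < Off" using False nonneg by simp
  have x: "0 \<le> x" using nonneg Off by (simp add: x_def)
  have \<eta>: "\<eta> / Off = real k * x" "30 / real k * \<eta> = 30 * x * Off" using k Off by (simp_all add: x_def)
  have lnk: "0 \<le> ln (real k)" using k by simp
  show ?thesis
  proof (cases "x \<le> 1")
    case True
    \<comment> \<open>The factor \<open>2 / 3\<close> comes from
      \<open>1 + 2 * x \<le> 3\<close>.\<close>
    have "x * (2 / 3) \<le> 2 * x / (1 + 2 * x)"
      using x True mult_left_mono[of x 1 x] by (simp add: field_simps)
    also have "\<dots> = 1 - 1 / (1 + 2 * x)" using x by (simp add: field_simps)
    \<comment> \<open>This is \<open>ln (1 + u) \<le> u\<close> where \<open>1 + u\<close> is the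
      reciprocal of \<open>1 + 2 * x\<close>.\<close>
    also have "\<dots> \<le> ln (1 + 2 * x)"
      using ln_add_one_self_le_self2[of "1 / (1 + 2 * x) - 1"] x by (simp add: ln_div)
    also have "\<dots> \<le> ln (1 + real k * x)"
      using x k mult_right_mono[of 2 "real k" x] by (intro ln_mono) auto
    finally have "14 + 30 * x \<le> 60 * (1 + ln (1 + \<eta> / Off))" using x unfolding \<eta> by simp
    then have "14 * Off + 30 / real k * \<eta> \<le> 60 * (1 + ln (1 + \<eta> / Off)) * Off"
      unfolding \<eta>(2) using mult_right_mono[of "14 + 30 * x" "60 * (1 + ln (1 + \<eta> / Off))" Off] Off
      by (simp add: algebra_simps)
    moreover have "24 * ln (real k) * Off \<le> 60 * ln (real k) * Off"
      using lnk Off by (intro mult_right_mono) auto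
    ultimately show ?thesis unfolding min_def
      by (simp only: split: if_split) (intro conjI impI; (rule TrueI | linarith))
  next
    case False
    \<comment> \<open>Now \<open>1 + \<eta> / Off\<close> exceeds \<open>k\<close>, so the minimum
      on the right is \<open>ln k\<close> and the marking bound suffices.\<close>
    have "real k * 1 \<le> real k * x" using False by (intro mult_left_mono) auto
    then have "real k \<le> 1 + real k * x" by simp
    then have "ln (real k) \<le> ln (1 + \<eta> / Off)" unfolding \<eta>(1) using k by (intro ln_mono) auto
    then have "min (1 + ln (1 + \<eta> / Off)) (ln (real k)) = ln (real k)" by simp
    moreover have "24 * ln (real k) * Off \<le> 60 * ln (real k) * Off"
      using lnk Off by (intro mult_right_mono) auto
    ultimately show ?thesis by (simp only: min.coboundedI2)
  qed
\<comment> \<open>For \<open>Off = 0\<close> the marking bound vanishes, and so do both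
  sides.\<close>
qed (use assms in simp)

theorem theorem3:
  "\<exists>C > 0. \<forall>(U :: 'a set) k. 2 \<le> k \<longrightarrow>
     (\<exists>A. caching_alg U k A \<and>
          competitive_against_offline U k A
            (\<lambda>\<eta> Off. C * min (1 + ln (1 + \<eta> / Off)) (ln (real k))))"
proof (intro exI[of _ "720 :: real"] conjI allI impI)
  fix U :: "'a set" and k :: nat
  assume k: "2 \<le> k"
  then have k1: "1 \<le> k" by simp
  define K where "K = combine k (follow k) (marking k :: 'a kernel)"
  have follow: "serving U k (follow k)"
    by (rule serving_block_kernel) (rule block_algorithm_follow[OF k1])
  have marking: "serving U k (marking k)"
    by (rule serving_block_kernel) (rule block_algorithm_marking[OF k1])
  have K: "serving U k K" unfolding K_def by (rule serving_combine[OF k1 follow marking])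
  show "\<exists>A. caching_alg U k A \<and>
    competitive_against_offline U k A (\<lambda>\<eta> Off. 720 * min (1 + ln (1 + \<eta> / Off)) (ln (real k)))"
  proof (intro exI conjI)
    show "caching_alg U k (alg_of K)" by (rule caching_alg_of[OF K])
    show "competitive_against_offline U k (alg_of K)
        (\<lambda>\<eta> Off. 720 * min (1 + ln (1 + \<eta> / Off)) (ln (real k)))"
      unfolding competitive_against_offline_def Let_def
    \<comment> \<open>The additive constant comes from \<open>cost_combine_min\<close> and depends
      on \<open>k\<close> only.\<close>
    proof (intro exI[of _ "6 * real k"] ballI allI impI)
      fix X0 \<sigma> Os
      assume X0: "X0 \<in> configs U k" and \<sigma>: "\<sigma> \<in> lists (U \<times> configs U k)"
        and Os: "serves U k (map fst \<sigma>) Os"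
      let ?Off = "movement_cost (X0 # Os)" and ?\<eta> = "prediction_error (map snd \<sigma>) Os"
      have "expected_cost (alg_of K) X0 \<sigma> = cost K X0 \<sigma>"
        using run_serving[OF K X0 \<sigma>] by blast
      also have "\<dots> \<le> 12 * min (cost (follow k) X0 \<sigma>) (cost (marking k) X0 \<sigma>) + 6 * real k"
        unfolding K_def by (rule cost_combine_min[OF k1 follow marking X0 \<sigma>])
      also have "min (cost (follow k) X0 \<sigma>) (cost (marking k) X0 \<sigma>) \<le>
          min (14 * ?Off + 30 / real k * ?\<eta>) (24 * ln (real k) * ?Off)"
        by (rule min.mono[OF cost_follow[OF k1 X0 \<sigma> Os] cost_marking[OF k X0 \<sigma> Os]])
      also have "\<dots> \<le> 60 * min (1 + ln (1 + ?\<eta> / ?Off)) (ln (real k)) * ?Off"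
        by (rule ratio_bound[OF k movement_cost_nonneg prediction_error_nonneg])
      \<comment> \<open>\<open>720 = 12 * 60\<close>: the loss from combining times the constant of
        \<open>ratio_bound\<close>.\<close>
      finally show "expected_cost (alg_of K) X0 \<sigma> \<le>
          720 * min (1 + ln (1 + ?\<eta> / ?Off)) (ln (real k)) * ?Off + 6 * real k"
        by simp
    qed
  qed
qed simp

end
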